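(* Assume $\overline Y:(\mathbb T\times\mathbb R)^2\times\mathbb R_+\to\mathbb R^2$ and $\rho:\mathbb T\times\mathbb R\to[0,h]$ (see context) are bounded together with all their derivatives of every order. For any given integer $L>0$ there is $\varepsilon_0>0$ such that for every $0\le\varepsilon<\varepsilon_0$: (1) There exist $\omega>0$ and an $L$ times differentiable map $W^0:\mathbb T\to\mathbb T\times\mathbb R$ with Lipschitz $L$-th derivative, whose lift satisfies $W^0(\theta+1)=W^0(\theta)+(1,0)^T$, which solve the zero-order equation $$\omega \frac{d}{d\theta}W^0(\theta)-\begin{pmatrix}\omega_0\\ \lambda_0W^0_2(\theta)\end{pmatrix}=\varepsilon\,\overline Y\big(W^0(\theta),\,W^0(\theta-\omega\rho(W^0(\theta))),\,\varepsilon\big),\qquad \theta\in\mathbb R. $$ (2) Moreover, let $\omega^0$ be a real number and $W^{0,0}$ a function of class $C^{L+Lip}$ with $W^{0,0}(\theta+1)=W^{0,0}(\theta)+(1,0)^T$, and suppose that they satisfy the zero-order equation up to an error $E^0$, i.e. $$E^0(\theta)=\omega^0\frac{d}{d\theta}W^{0,0}(\theta)-\begin{pmatrix}\omega_0\\ \lambda_0W^{0,0}_2(\theta)\end{pmatrix}-\varepsilon\,\overline Y\big(W^{0,0}(\theta),W^{0,0}(\theta-\omega^0\rho(W^{0,0}(\theta))),\varepsilon\big).$$ Then there exist $\omega$ and $W^0$ (with $W^0(\theta+1)=W^0(\theta)+(1,0)^T$), unique up to a phase shift $W^0(\cdot)\mapsto W^0(\cdot+\theta_0)$ of $W^0$,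 solving the zero-order equation exactly; and (with a suitable choice of the phase of $W^0$) $$\|W^{0,0}-W^0\|_{C^l}\le C\|E^0\|_{C^0}^{1-\frac lL}\quad(0\le l<L),\qquad |\omega^0-\omega|\le C\|E^0\|_{C^0},$$ for some constant $C$ which may depend on $\varepsilon,\omega_0,\lambda_0,l,L$ and on an a priori bound for $\|W^{0,0}\|_{L+Lip}$. (3) In fact, $W^0$ has derivatives up to any order.
   Context: Setting. $\mathbb T=\mathbb R/\mathbb Z$, $\mathbb R_+=[0,\infty)$. $X:\mathbb R^2\times\mathbb R^2\to\mathbb R^2$ is analytic, $X_0(x)=X(x,0)$, and the planar ODE $\dot x=X_0(x)$ has a stable limit cycle; $r:\mathbb R^2\to[0,h]$ is smooth. The state-dependent delay equation (SDDE) is $\dot x(t)=X(x(t),\varepsilon x(t-r(x(t))))$, $\varepsilon\ge0$. Fixed given data: $\omega_0>0$, $\lambda_0<0$ and an analytic local diffeomorphism $K:\mathbb T\times[-1,1]\to\mathbb R^2$ with $X_0(K(\theta,s))=DK(\theta,s)(\omega_0,\lambda_0 s)^T$; $\theta\mapsto K(\theta,0)$ parameterizes the limit cycle. Let $P$ be defined by $\varepsilon P(x,y,\varepsilon)=X(x,\varepsilon y)-X(x,0)$, and $Y(u,v,\varepsilon)=(DK(u))^{-1}P(K(u),K(v),\varepsilon)$ for $u,v\in\mathbb T\times[-1,1]$. Let $\phi:\mathbb R\to[0,1]$ be a $C^\infty$ function with $\phi(x)=1$ for $|x|\le\frac12$ and $\phi(x)=0$ for $|x|>1$. Put $\rho(\theta,s)=r(K(\theta,s))\phi(s)$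 (zero for $|s|>1$), and $\overline Y(u,v,\varepsilon)=Y(u,v,\varepsilon)\phi(u_2)\phi(v_2)$ (zero if $|u_2|>1$ or $|v_2|>1$), where subscripts denote components. Maps into $\mathbb T\times\mathbb R$ are identified with their lifts to $\mathbb R^2$-valued functions on $\mathbb R$. $C^{L+Lip}$ means $L$ times continuously differentiable with Lipschitz $L$-th derivative; $\|f\|_{L+Lip}=\max_{i=1,2,\;0\le k\le L}\{\sup_{\theta\in[0,1]}|f_i^{(k)}(\theta)|,\ \mathrm{Lip}(f_i^{(L)})\}$. $\|f\|_{C^l}$ is the maximum of the sup norms of the derivatives of orders $0,\dots,l$. *)

theory Defs
  imports "HOL-Analysis.Analysis"
begin

text \<open>
  The plane is \<^typ>\<open>real \<times> real\<close>. Functions on the circle are represented by their lifts: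
  functions on \<^typ>\<open>real\<close> (or on \<^typ>\<open>real \<times> real\<close>) that are 1-periodic in the angle.
\<close>

text \<open>
  Near every point of \<open>S\<close>, \<open>f\<close> is the restriction to \<open>S\<close> of a function \<open>F\<close> given on a full ball by
  a convergent power series; the exponents \<open>\<alpha>\<close> are multi-indices over the coordinates.
\<close>

definition real_analytic_on ::
  "('a::euclidean_space \<Rightarrow> 'b::euclidean_space) \<Rightarrow> 'a set \<Rightarrow> bool" where
  "real_analytic_on f S \<longleftrightarrow>
    (\<forall>x\<in>S. \<exists>\<delta>>0. \<exists>F c. \<forall>y\<in>ball x \<delta>.
       ((\<lambda>\<alpha>::'a \<Rightarrow> nat. (\<Prod>b\<in>Basis. ((y - x) \<bullet> b) ^ \<alpha> b) *\<^sub>R c \<alpha>) has_sum F y) (Basis \<rightarrow>\<^sub>E UNIV) \<and>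
       (y \<in> S \<longrightarrow> f y = F y))"

definition analytic_local_diffeo_on ::
  "('a::euclidean_space \<Rightarrow> 'b::euclidean_space) \<Rightarrow> 'a set \<Rightarrow> bool" where
  "analytic_local_diffeo_on f S \<longleftrightarrow>
    real_analytic_on f S \<and>
    (\<forall>x\<in>S. \<exists>U g. open U \<and> x \<in> U \<and> (\<forall>y\<in>U \<inter> S. g (f y) = y) \<and> real_analytic_on g (f ` (U \<inter> S)))"

text \<open>
  \<open>D [v\<^sub>n, \<dots>, v\<^sub>1] x\<close> is the \<open>n\<close>-th Frechet derivative of \<open>f\<close> at \<open>x\<close> applied to \<open>v\<^sub>1, \<dots>, v\<^sub>n\<close>.
  The derivatives are taken within \<open>S\<close>; below \<open>S\<close> is the whole space or a closed half-space, where
  they are unique.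
\<close>

definition derivative_family ::
  "('a::real_normed_vector list \<Rightarrow> 'a \<Rightarrow> 'b::real_normed_vector) \<Rightarrow> ('a \<Rightarrow> 'b) \<Rightarrow> 'a set \<Rightarrow> bool" where
  "derivative_family D f S \<longleftrightarrow>
    (\<forall>x\<in>S. D [] x = f x) \<and>
    (\<forall>vs. \<forall>x\<in>S. (D vs has_derivative (\<lambda>v. D (v # vs) x)) (at x within S))"

definition smooth_on ::
  "('a::euclidean_space \<Rightarrow> 'b::euclidean_space) \<Rightarrow> 'a set \<Rightarrow> bool" where
  "smooth_on f S \<longleftrightarrow> (\<exists>D. derivative_family D f S)"

definition bounded_smooth_on ::
  "('a::euclidean_space \<Rightarrow> 'b::euclidean_space) \<Rightarrow> 'a set \<Rightarrow> bool" where
  "bounded_smooth_on f S \<longleftrightarrow> (\<exists>D. derivative_family D f S \<and> (\<forall>vs. bounded (D vs ` S)))"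

definition closed_orbit :: "('a::real_normed_vector \<Rightarrow> 'a) \<Rightarrow> 'a set \<Rightarrow> bool" where
  "closed_orbit f \<Gamma> \<longleftrightarrow>
    (\<exists>x T. T > 0 \<and> (\<forall>t. (x has_vector_derivative f (x t)) (at t)) \<and>
       (\<forall>t. x (t + T) = x t) \<and> \<not> x constant_on UNIV \<and> \<Gamma> = range x)"

definition limit_cycle :: "('a::real_normed_vector \<Rightarrow> 'a) \<Rightarrow> 'a set \<Rightarrow> bool" where
  "limit_cycle f \<Gamma> \<longleftrightarrow>
    closed_orbit f \<Gamma> \<and>
    (\<exists>U. open U \<and> \<Gamma> \<subseteq> U \<and> (\<forall>\<Gamma>'. closed_orbit f \<Gamma>' \<and> \<Gamma>' \<subseteq> U \<longrightarrow> \<Gamma>' = \<Gamma>))"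

definition forward_solution ::
  "('a::real_normed_vector \<Rightarrow> 'a) \<Rightarrow> 'a \<Rightarrow> (real \<Rightarrow> 'a) \<Rightarrow> bool" where
  "forward_solution f a x \<longleftrightarrow>
    x 0 = a \<and> (\<forall>t\<ge>0. (x has_vector_derivative f (x t)) (at t within {0..}))"

text \<open>Stability is asymptotic orbital stability.\<close>

definition stable_limit_cycle :: "('a::real_normed_vector \<Rightarrow> 'a) \<Rightarrow> 'a set \<Rightarrow> bool" where
  "stable_limit_cycle f \<Gamma> \<longleftrightarrow>
    limit_cycle f \<Gamma> \<and>
    (\<forall>\<eta>>0. \<exists>\<delta>>0. \<forall>a. infdist a \<Gamma> < \<delta> \<longrightarrow>
       (\<exists>x. forward_solution f a x \<and> (\<forall>t\<ge>0. infdist (x t) \<Gamma> < \<eta>))) \<and>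
    (\<exists>\<delta>>0. \<forall>a. infdist a \<Gamma> < \<delta> \<longrightarrow>
       (\<exists>x. forward_solution f a x \<and> ((\<lambda>t. infdist (x t) \<Gamma>) \<longlongrightarrow> 0) at_top))"

definition strip :: "(real \<times> real) set" where
  "strip = UNIV \<times> {-1..1}"

definition DK :: "(real \<times> real \<Rightarrow> real \<times> real) \<Rightarrow> real \<times> real \<Rightarrow> real \<times> real \<Rightarrow> real \<times> real" where
  "DK K u = frechet_derivative K (at u within strip)"

text \<open>
  \<open>P\<close> is defined by \<open>\<epsilon> P(x, y, \<epsilon>) = X(x, \<epsilon> y) - X(x, 0)\<close>. At \<open>\<epsilon> = 0\<close> this relation is void, and
  \<open>P(x, y, 0)\<close> is the continuous (indeed analytic) extension, namely the derivative of \<open>X(x, \<cdot>)\<close> at 0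
  in the direction \<open>y\<close>.
\<close>

definition P_pert ::
  "((real \<times> real) \<times> (real \<times> real) \<Rightarrow> real \<times> real) \<Rightarrow> real \<times> real \<Rightarrow> real \<times> real \<Rightarrow> real \<Rightarrow> real \<times> real" where
  "P_pert X x y \<epsilon> =
    (if \<epsilon> = 0 then frechet_derivative (\<lambda>z. X (x, z)) (at 0) y
     else (X (x, \<epsilon> *\<^sub>R y) - X (x, 0)) /\<^sub>R \<epsilon>)"

definition Y_pert ::
  "((real \<times> real) \<times> (real \<times> real) \<Rightarrow> real \<times> real) \<Rightarrow> (real \<times> real \<Rightarrow> real \<times> real) \<Rightarrow>
    real \<times> real \<Rightarrow> real \<times> real \<Rightarrow> real \<Rightarrow> real \<times> real" where
  "Y_pert X K u v \<epsilon> = inv (DK K u) (P_pert X (K u) (K v) \<epsilon>)"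

definition Y_bar ::
  "((real \<times> real) \<times> (real \<times> real) \<Rightarrow> real \<times> real) \<Rightarrow> (real \<times> real \<Rightarrow> real \<times> real) \<Rightarrow>
    (real \<Rightarrow> real) \<Rightarrow> (real \<times> real) \<times> (real \<times> real) \<times> real \<Rightarrow> real \<times> real" where
  "Y_bar X K \<phi> = (\<lambda>(u, v, \<epsilon>).
    if \<bar>snd u\<bar> > 1 \<or> \<bar>snd v\<bar> > 1 then 0 else (\<phi> (snd u) * \<phi> (snd v)) *\<^sub>R Y_pert X K u v \<epsilon>)"

definition rho_bar ::
  "(real \<times> real \<Rightarrow> real) \<Rightarrow> (real \<times> real \<Rightarrow> real \<times> real) \<Rightarrow> (real \<Rightarrow> real) \<Rightarrow> real \<times> real \<Rightarrow> real" where
  "rho_bar r K \<phi> u = (if \<bar>snd u\<bar> > 1 then 0 else r (K u) * \<phi> (snd u))"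

definition circle_lift :: "(real \<Rightarrow> real \<times> real) \<Rightarrow> bool" where
  "circle_lift W \<longleftrightarrow> (\<forall>\<theta>. W (\<theta> + 1) = W \<theta> + (1, 0))"

definition C_class :: "nat \<Rightarrow> (real \<Rightarrow> real \<times> real) \<Rightarrow> bool" where
  "C_class n f \<longleftrightarrow>
    (\<forall>g\<in>{fst \<circ> f, snd \<circ> f}.
       (\<forall>k<n. \<forall>x. (deriv ^^ k) g field_differentiable at x) \<and> continuous_on UNIV ((deriv ^^ n) g))"

definition C_Lip_class :: "nat \<Rightarrow> (real \<Rightarrow> real \<times> real) \<Rightarrow> bool" where
  "C_Lip_class n f \<longleftrightarrow>
    C_class n f \<and> (\<forall>g\<in>{fst \<circ> f, snd \<circ> f}. \<exists>M. M-lipschitz_on UNIV ((deriv ^^ n) g))"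

definition Lip_const :: "(real \<Rightarrow> real) \<Rightarrow> real" where
  "Lip_const g = Inf {M. M-lipschitz_on UNIV g}"

text \<open>
  The suprema run over a fundamental domain of the circle. For 1-periodic functions this is the
  supremum over \<^typ>\<open>real\<close>; the first component of a lift is itself unbounded on \<^typ>\<open>real\<close>.
\<close>

definition C_norm :: "nat \<Rightarrow> (real \<Rightarrow> real \<times> real) \<Rightarrow> real" where
  "C_norm n f =
    Max (\<Union>g\<in>{fst \<circ> f, snd \<circ> f}. (\<lambda>k. SUP \<theta>\<in>{0..1}. \<bar>(deriv ^^ k) g \<theta>\<bar>) ` {..n})"

definition C_Lip_norm :: "nat \<Rightarrow> (real \<Rightarrow> real \<times> real) \<Rightarrow> real" where
  "C_Lip_norm n f =
    max (C_norm n f) (Max ((\<lambda>g. Lip_const ((deriv ^^ n) g)) ` {fst \<circ> f, snd \<circ> f}))"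

definition zero_order_error ::
  "real \<Rightarrow> real \<Rightarrow> ((real \<times> real) \<times> (real \<times> real) \<times> real \<Rightarrow> real \<times> real) \<Rightarrow> (real \<times> real \<Rightarrow> real) \<Rightarrow>
    real \<Rightarrow> real \<Rightarrow> (real \<Rightarrow> real \<times> real) \<Rightarrow> real \<Rightarrow> real \<times> real" where
  "zero_order_error \<omega>\<^sub>0 lam\<^sub>0 Y \<rho> \<epsilon> \<omega> W \<theta> =
    \<omega> *\<^sub>R vector_derivative W (at \<theta>) - (\<omega>\<^sub>0, lam\<^sub>0 * snd (W \<theta>))
      - \<epsilon> *\<^sub>R Y (W \<theta>, W (\<theta> - \<omega> * \<rho> (W \<theta>)), \<epsilon>)"

definition zero_order_solution ::
  "real \<Rightarrow> real \<Rightarrow> ((real \<times> real) \<times> (real \<times> real) \<times> real \<Rightarrow> real \<times> real) \<Rightarrow> (real \<times> real \<Rightarrow> real) \<Rightarrow>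
    real \<Rightarrow> real \<Rightarrow> (real \<Rightarrow> real \<times> real) \<Rightarrow> bool" where
  "zero_order_solution \<omega>\<^sub>0 lam\<^sub>0 Y \<rho> \<epsilon> \<omega> W \<longleftrightarrow>
    circle_lift W \<and> (\<forall>\<theta>. W differentiable at \<theta>) \<and>
    (\<forall>\<theta>. \<omega> *\<^sub>R vector_derivative W (at \<theta>) - (\<omega>\<^sub>0, lam\<^sub>0 * snd (W \<theta>))
          = \<epsilon> *\<^sub>R Y (W \<theta>, W (\<theta> - \<omega> * \<rho> (W \<theta>)), \<epsilon>))"

end

theory Submission
  imports Defs
begin

text \<open>
  For a fixed forcing \<open>g\<close>, the equation \<open>\<omega> P' = (\<omega>\<^sub>0, \<lambda>\<^sub>0 P\<^sub>2) + g\<close> determines \<open>\<omega>\<close> and, after fixing the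
  phase by \<open>P\<^sub>1 0 = 0\<close>, the circle map \<open>P\<close>. Integrating the first component over a period and applying
  the maximum principle to the second shows that \<open>(\<omega>, P)\<close> depends on \<open>g\<close> in a Lipschitz way in the
  supremum norm and that \<open>P\<close> has Lipschitz constant 3 as soon as \<open>\<bar>g\<bar> \<le> \<omega>\<^sub>0 / 4\<close>. The
  right-hand side of the zero-order equation is Lipschitz in \<open>(\<omega>, W)\<close> on such maps with a constant
  of order \<open>\<epsilon>\<close>. For small \<open>\<epsilon>\<close>, Banach's fixed point theorem gives existence, and the same stability
  estimate gives uniqueness and a bound on the distance to a solution by the error. It only asks the
  exact solution to be Lipschitz with constant 3, so \<open>\<epsilon>\<^sub>0\<close> does not depend on the a priori bound of
  the approximate one. Intermediate derivatives are controlled by Landau's inequality, and the equation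
  itself bootstraps regularity.
\<close>

section \<open>Periodic solutions of scalar linear equations\<close>

text \<open>The obstacle is the state-dependent delay: varying \<open>W\<close> in
  \<open>W (\<theta> - \<omega> * \<rho> (W \<theta>))\<close> also moves the point of evaluation,
  so the right-hand side is Lipschitz in the supremum norm only where a slope bound is available.
  The slope bound is therefore part of the closed set on which the contraction acts, while distances
  are measured in the supremum norm alone. When two curves are compared, one slope bound suffices;
  this lets an arbitrary approximate solution be compared with the exact one. The frequency is no
  free parameter: it is the solvability condition of the first component, and the phase is the
  matching freedom. Only suprema and Lipschitz constants of the data enter the smallness condition;
  higher regularity comes afterwards. The comparison argument requires a small error; for a large
  error, the a priori bound on the curves is itself at most a constant times the error. The exponent
  \<open>1 - l / L\<close> arises by interpolating between a supremum norm of the order of the error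
  and bounded derivatives of order \<open>L\<close>.\<close>

lemma antiderivative_exists:
  fixes g :: "real \<Rightarrow> real"
  assumes "continuous_on UNIV g"
  obtains F where "\<And>x. (F has_real_derivative g x) (at x)"
proof -
  have "\<exists>F. \<forall>x::real. (-\<infinity>::ereal) < x \<longrightarrow> x < (\<infinity>::ereal) \<longrightarrow> (F has_vector_derivative g x) (at x)"
    by (rule einterval_antiderivative)
       (use assms in \<open>auto simp: continuous_on_eq_continuous_at\<close>)
  then show ?thesis
    using that by (auto simp: has_real_derivative_iff_has_vector_derivative)
qed

lemma increment_bound:
  fixes f :: "real \<Rightarrow> real"
  assumes "\<And>x. (f has_real_derivative f' x) (at x)" "\<And>x. \<bar>f' x\<bar> \<le> c"
  shows "\<bar>f y - f x\<bar> \<le> c * \<bar>y - x\<bar>"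
  using field_differentiable_bound[of UNIV f f' c y x] assms by simp

lemma shift_derivative:
  assumes "\<And>x. (f has_vector_derivative f' x) (at x)"
  shows "((\<lambda>x. f (x + a)) has_vector_derivative f' (x + a)) (at x)"
  using vector_diff_chain_at[of "\<lambda>x. x + a" 1 x f "f' (x + a)"] assms[of "x + a"]
  by (simp add: o_def has_vector_derivative_add_const)

lemma periodic_fundamental_domain:
  fixes f :: "real \<Rightarrow> 'a"
  assumes "\<And>x. f (x + 1) = f x"
  shows "f (frac x) = f x"
proof -
  have n: "f (x + real n) = f x" for x n
  proof (induction n)
    case (Suc n)
    have "f (x + real (Suc n)) = f (x + real n + 1)"
      by (simp add: algebra_simps)
    then show ?case
      using Suc assms by simp
  qed simp
  have "f (x + of_int k) = f x" for x k
    using n[of x "nat k"] n[of "x + of_int k" "nat (-k)"]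
    by (cases "k \<ge> 0") auto
  from this[of "frac x" "\<lfloor>x\<rfloor>"] show ?thesis
    by (simp add: frac_def)
qed

lemma periodic_le:
  fixes f :: "real \<Rightarrow> 'a::order"
  assumes "\<And>x. f (x + 1) = f x" "\<And>x. x \<in> {0..1} \<Longrightarrow> f x \<le> c"
  shows "f x \<le> c"
  using periodic_fundamental_domain[of f x, OF assms(1)] assms(2)[of "frac x"]
  by (simp add: frac_ge_0 less_imp_le[OF frac_lt_1])

lemma periodic_continuous_bounded:
  fixes f :: "real \<Rightarrow> 'a::real_normed_vector"
  assumes "continuous_on UNIV f" "\<And>x. f (x + 1) = f x"
  obtains b where "b \<ge> 0" "\<And>x. norm (f x) \<le> b"
proof -
  have "compact (f ` {0..1})"
    using assms(1) by (intro compact_continuous_image) (auto intro: continuous_on_subset)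
  then obtain b where b: "\<And>x. x \<in> {0..1} \<Longrightarrow> norm (f x) \<le> b"
    using compact_imp_bounded bounded_iff by (metis image_eqI)
  have "norm (f x) \<le> b" for x
    by (rule periodic_le[of "\<lambda>x. norm (f x)"]) (use assms(2) b in auto)
  moreover have "b \<ge> 0"
    using b[of 0] norm_ge_zero[of "f 0"] by (simp del: norm_ge_zero)
  ultimately show ?thesis
    using that by blast
qed

text \<open>At a maximum of \<open>p\<close> the derivative term drops out of the equation.\<close>

lemma linear_ode_upper_bound:
  fixes p q :: "real \<Rightarrow> real"
  assumes p: "\<And>x. (p has_real_derivative p' x) (at x)" and per: "\<And>x. p (x + 1) = p x"
    and eq: "\<And>x. \<omega> * p' x = lam * p x + q x" and q: "\<And>x. \<bar>q x\<bar> \<le> c" and "lam < 0"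
  shows "p x \<le> c / \<bar>lam\<bar>"
proof -
  have cont: "continuous_on UNIV p"
    using p DERIV_isCont by (blast intro: continuous_at_imp_continuous_on)
  obtain t where t: "t \<in> {0..1}" "\<And>x. x \<in> {0..1} \<Longrightarrow> p x \<le> p t"
    using continuous_attains_sup[of "{0..1::real}" p] continuous_on_subset[OF cont subset_UNIV]
    by auto
  have max: "p x \<le> p t" for x
    by (rule periodic_le[of p, OF per]) (use t in auto)
  have "p' t = 0"
    using DERIV_local_max[OF p, of 1] max by simp
  with eq[of t] q[of t] have "\<bar>lam\<bar> * p t \<le> c"
    using \<open>lam < 0\<close> by simp
  then have "p t \<le> c / \<bar>lam\<bar>"
    using \<open>lam < 0\<close> by (simp add: field_simps)
  with max[of x] show ?thesis
    by simp
qed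

lemma linear_ode_bound:
  fixes p q :: "real \<Rightarrow> real"
  assumes p: "\<And>x. (p has_real_derivative p' x) (at x)" and per: "\<And>x. p (x + 1) = p x"
    and eq: "\<And>x. \<omega> * p' x = lam * p x + q x" and q: "\<And>x. \<bar>q x\<bar> \<le> c" and "lam < 0"
  shows "\<bar>p x\<bar> \<le> c / \<bar>lam\<bar>"
proof -
  have "p x \<le> c / \<bar>lam\<bar>"
    by (rule linear_ode_upper_bound[OF assms])
  moreover have "- p x \<le> c / \<bar>lam\<bar>"
    by (rule linear_ode_upper_bound[of "\<lambda>x. - p x" "\<lambda>x. - p' x" \<omega> lam "\<lambda>x. - q x"])
       (use assms in \<open>auto intro!: derivative_eq_intros simp: algebra_simps\<close>)
  ultimately show ?thesis
    by linarith
qed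

text \<open>Variation of constants: \<open>exp (\<mu> * x) * p x\<close> must be an antiderivative
  of \<open>exp (\<mu> * x) * q x / \<omega>\<close>, and the constant of integration is used to
  make \<open>p\<close> periodic.\<close>

lemma linear_ode_periodic_solution:
  fixes q :: "real \<Rightarrow> real"
  assumes q: "continuous_on UNIV q" "\<And>x. q (x + 1) = q x" and "lam < 0" "\<omega> > 0"
  obtains p p' where "\<And>x. (p has_real_derivative p' x) (at x)" "\<And>x. p (x + 1) = p x"
    "\<And>x. \<omega> * p' x = lam * p x + q x"
proof -
  define \<mu> where "\<mu> = - lam / \<omega>"
  have \<mu>: "\<mu> > 0" "\<omega> * \<mu> = - lam"
    using assms by (auto simp: \<mu>_def field_simps)
  obtain F where F: "\<And>x. (F has_real_derivative exp (\<mu> * x) * q x / \<omega>) (at x)"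
    by (rule antiderivative_exists[of "\<lambda>x. exp (\<mu> * x) * q x / \<omega>"])
       (use assms in \<open>auto intro!: continuous_intros\<close>)
  have shift: "((\<lambda>x. F (x + 1)) has_real_derivative exp \<mu> * (exp (\<mu> * x) * q x / \<omega>)) (at x)" for x
    using F[of "x + 1"] q(2) unfolding DERIV_shift by (simp add: exp_add distrib_left mult_ac)
  have "\<exists>k. \<forall>x. F (x + 1) - exp \<mu> * F x = k"
  proof (intro exI allI)
    fix x
    show "F (x + 1) - exp \<mu> * F x = F (0 + 1) - exp \<mu> * F 0"
      by (rule DERIV_isconst_all[of "\<lambda>x. F (x + 1) - exp \<mu> * F x"])
         (auto intro!: derivative_eq_intros F shift)
  qed
  then obtain k where k: "\<And>x. F (x + 1) = exp \<mu> * F x + k"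
    by (metis add.commute diff_add_cancel)
  \<comment> \<open>Chosen so that \<open>F + c\<close> is multiplied by exactly
    \<open>exp \<mu>\<close> over one period, which cancels the factor \<open>exp (- \<mu>)\<close>
    gained by the exponential in \<open>p\<close>. The denominator is positive because \<mu> >
    0.\<close>
  define c where "c = k / (exp \<mu> - 1)"
  have "exp \<mu> > 1"
    using \<mu> by simp
  then have c: "k + c = exp \<mu> * c"
    by (simp add: c_def field_simps)
  define p where "p = (\<lambda>x. exp (- (\<mu> * x)) * (F x + c))"
  show ?thesis
  proof
    show "(p has_real_derivative - \<mu> * p x + q x / \<omega>) (at x)" for x
      unfolding p_def
      by (auto intro!: derivative_eq_intros F simp: algebra_simps exp_minus)
    show "p (x + 1) = p x" for x
    proof -
      have e: "exp (- (\<mu> * (x + 1))) = exp (- (\<mu> * x)) * exp (- \<mu>)"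
        using exp_add[of "- (\<mu> * x)" "- \<mu>"] by (simp add: algebra_simps)
      have "p (x + 1) = exp (- (\<mu> * x)) * (exp (-\<mu>) * (exp \<mu> * F x + (k + c)))"
        unfolding p_def k e by (simp only: mult.assoc add.assoc)
      also have "exp (-\<mu>) * (exp \<mu> * F x + (k + c)) = F x + c"
        unfolding c by (simp add: exp_minus field_simps)
      finally show ?thesis
        by (simp add: p_def)
    qed
    show "\<omega> * (- \<mu> * p x + q x / \<omega>) = lam * p x + q x" for x
    proof -
      have "\<omega> * (- \<mu> * p x + q x / \<omega>) = - (\<omega> * \<mu>) * p x + q x"
        using \<open>\<omega> > 0\<close> by (simp add: right_diff_distrib)
      then show ?thesis
        by (simp add: \<mu>(2))
    qed
  qed
qed

section \<open>The linear equation with a given forcing\<close>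

text \<open>The forcing is an argument of its own, so that exact solutions, approximate solutions
  (forcing plus residual) and steps of the fixed point iteration are all instances and can be
  compared by the same estimates.\<close>

definition forced_solution ::
  "real \<Rightarrow> real \<Rightarrow> real \<Rightarrow> (real \<Rightarrow> real \<times> real) \<Rightarrow> (real \<Rightarrow> real \<times> real) \<Rightarrow> bool" where
  "forced_solution w lam \<omega> P g \<longleftrightarrow>
    circle_lift P \<and>
    (\<exists>P'. \<forall>\<theta>. (P has_vector_derivative P' \<theta>) (at \<theta>) \<and>
       \<omega> *\<^sub>R P' \<theta> = (w, lam * snd (P \<theta>)) + g \<theta>)"

lemma has_vector_derivative_prod_iff:
  "(f has_vector_derivative f') (at x) \<longleftrightarrow>
    ((\<lambda>x. fst (f x)) has_real_derivative fst f') (at x) \<and>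
    ((\<lambda>x. snd (f x)) has_real_derivative snd f') (at x)"
proof
  assume "(f has_vector_derivative f') (at x)"
  then show "((\<lambda>x. fst (f x)) has_real_derivative fst f') (at x) \<and>
    ((\<lambda>x. snd (f x)) has_real_derivative snd f') (at x)"
    unfolding has_real_derivative_iff_has_vector_derivative
    by (auto intro: bounded_linear.has_vector_derivative bounded_linear_fst bounded_linear_snd)
next
  assume "((\<lambda>x. fst (f x)) has_real_derivative fst f') (at x) \<and>
    ((\<lambda>x. snd (f x)) has_real_derivative snd f') (at x)"
  then have "((\<lambda>x. (fst (f x), snd (f x))) has_vector_derivative (fst f', snd f')) (at x)"
    unfolding has_real_derivative_iff_has_vector_derivative
    by (intro has_vector_derivative_Pair) auto
  then show "(f has_vector_derivative f') (at x)"
    by simp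
qed

lemma abs_fst_le_norm: "\<bar>fst (x :: real \<times> real)\<bar> \<le> norm x"
  and abs_snd_le_norm: "\<bar>snd (x :: real \<times> real)\<bar> \<le> norm x"
  and norm_le_abs_sum: "norm (x :: real \<times> real) \<le> \<bar>fst x\<bar> + \<bar>snd x\<bar>"
proof -
  show "\<bar>fst x\<bar> \<le> norm x"
    using norm_fst_le[of "fst x" "snd x"] by simp
  show "\<bar>snd x\<bar> \<le> norm x"
    using norm_snd_le[of "snd x" "fst x"] by simp
  show "norm x \<le> \<bar>fst x\<bar> + \<bar>snd x\<bar>"
    using norm_Pair_le[of "fst x" "snd x"] by simp
qed

lemma forced_solutionE:
  assumes "forced_solution w lam \<omega> P g"
  obtains P' where "\<And>\<theta>. P (\<theta> + 1) = P \<theta> + (1, 0)"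
    "\<And>\<theta>. (P has_vector_derivative P' \<theta>) (at \<theta>)"
    "\<And>\<theta>. \<omega> * fst (P' \<theta>) = w + fst (g \<theta>)"
    "\<And>\<theta>. \<omega> * snd (P' \<theta>) = lam * snd (P \<theta>) + snd (g \<theta>)"
proof -
  obtain P' where P': "\<And>\<theta>. P (\<theta> + 1) = P \<theta> + (1, 0)"
    "\<And>\<theta>. (P has_vector_derivative P' \<theta>) (at \<theta>)"
    "\<And>\<theta>. \<omega> *\<^sub>R P' \<theta> = (w, lam * snd (P \<theta>)) + g \<theta>"
    using assms unfolding forced_solution_def circle_lift_def by blast
  have "\<omega> * fst (P' \<theta>) = w + fst (g \<theta>)" "\<omega> * snd (P' \<theta>) = lam * snd (P \<theta>) + snd (g \<theta>)" for \<theta>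
    using arg_cong[OF P'(3)[of \<theta>], of fst] arg_cong[OF P'(3)[of \<theta>], of snd] by auto
  with P'(1,2) that show ?thesis
    by blast
qed

text \<open>The unperturbed solution, of frequency \<open>w\<close>. Comparing with it turns
  estimates for differences of frequencies into bounds on \<open>\<omega> - w\<close>.\<close>

lemma forced_solution_identity: "forced_solution w lam w (\<lambda>\<theta>. (\<theta>, 0)) (\<lambda>\<theta>. 0)"
  unfolding forced_solution_def circle_lift_def
  by (intro conjI exI[of _ "\<lambda>\<theta>. (1, 0)"]) (auto intro!: derivative_eq_intros)

text \<open>A lift gains exactly 1 in its first component over a period, so integrating the first
  equation gives that \<omega> is \<open>w\<close> plus the mean of \<open>fst (g \<theta>)\<close>.
  Hence the difference of the frequencies is the mean of
  \<open>fst (g \<theta> - k \<theta>)\<close>, here the increment of \<open>F\<close> over a unit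
  interval.\<close>

lemma frequency_diff:
  assumes "forced_solution w lam \<omega> P g" "forced_solution w lam \<omega>' Q k"
    and c: "\<And>\<theta>. norm (g \<theta> - k \<theta>) \<le> c"
  shows "\<bar>\<omega> - \<omega>'\<bar> \<le> c"
proof -
  obtain P' where P: "\<And>\<theta>. P (\<theta> + 1) = P \<theta> + (1, 0)"
    "\<And>\<theta>. (P has_vector_derivative P' \<theta>) (at \<theta>)"
    "\<And>\<theta>. \<omega> * fst (P' \<theta>) = w + fst (g \<theta>)"
    "\<And>\<theta>. \<omega> * snd (P' \<theta>) = lam * snd (P \<theta>) + snd (g \<theta>)"
    by (rule forced_solutionE[OF assms(1)]) (rule that)
  note P_deriv = P(2)[unfolded has_vector_derivative_prod_iff]
  note P_fst = P_deriv[THEN conjunct1] and P_snd = P_deriv[THEN conjunct2]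
  obtain Q' where Q: "\<And>\<theta>. Q (\<theta> + 1) = Q \<theta> + (1, 0)"
    "\<And>\<theta>. (Q has_vector_derivative Q' \<theta>) (at \<theta>)"
    "\<And>\<theta>. \<omega>' * fst (Q' \<theta>) = w + fst (k \<theta>)"
    "\<And>\<theta>. \<omega>' * snd (Q' \<theta>) = lam * snd (Q \<theta>) + snd (k \<theta>)"
    by (rule forced_solutionE[OF assms(2)]) (rule that)
  note Q_deriv = Q(2)[unfolded has_vector_derivative_prod_iff]
  note Q_fst = Q_deriv[THEN conjunct1] and Q_snd = Q_deriv[THEN conjunct2]
  define F where "F = (\<lambda>\<theta>. \<omega> * fst (P \<theta>) - \<omega>' * fst (Q \<theta>))"
  have "(F has_real_derivative (fst (g x - k x))) (at x)" for x
    using P(3)[of x] Q(3)[of x] unfolding F_def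
    by (auto intro!: derivative_eq_intros P_fst Q_fst simp: mult.commute)
  moreover have "\<bar>fst (g x - k x)\<bar> \<le> c" for x
    using c[of x] abs_fst_le_norm order_trans by blast
  ultimately have "\<bar>F (0 + 1) - F 0\<bar> \<le> c * \<bar>(0 + 1) - 0\<bar>"
    by (rule increment_bound)
  then show ?thesis
    unfolding F_def P(1) Q(1) by (simp add: algebra_simps)
qed

lemma forced_solution_frequency:
  assumes P: "forced_solution w lam \<omega> P g" and g: "\<And>\<theta>. norm (g \<theta>) \<le> w / 4"
  shows "\<bar>\<omega> - w\<bar> \<le> w / 4"
  by (rule frequency_diff[OF P forced_solution_identity]) (use g in simp)

text \<open>The components of the right-hand side are at most \<open>5 / 4 * w\<close> and
  \<open>w / 2\<close>, the latter since the maximum principle gives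
  \<open>\<bar>lam * snd (P \<theta>)\<bar> \<le> w / 4\<close>. Dividing their sum
  \<open>7 / 4 * w\<close> by \<open>\<bar>\<omega>\<bar> \<ge> 3 / 4 * w\<close> leaves 7/3,
  rounded up to 3.\<close>

lemma forced_solution_derivative_bound:
  assumes P: "forced_solution w lam \<omega> P g" and g: "\<And>\<theta>. norm (g \<theta>) \<le> w / 4"
    and v: "(P has_vector_derivative v) (at t)" and "lam < 0" "w > 0"
  shows "norm v \<le> 3"
proof -
  have freq: "\<bar>\<omega> - w\<bar> \<le> w / 4"
    by (rule forced_solution_frequency[OF P g])
  obtain P' where P': "\<And>\<theta>. P (\<theta> + 1) = P \<theta> + (1, 0)"
    "\<And>\<theta>. (P has_vector_derivative P' \<theta>) (at \<theta>)"
    "\<And>\<theta>. \<omega> * fst (P' \<theta>) = w + fst (g \<theta>)"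
    "\<And>\<theta>. \<omega> * snd (P' \<theta>) = lam * snd (P \<theta>) + snd (g \<theta>)"
    by (rule forced_solutionE[OF P]) (rule that)
  note P_deriv = P'(2)[unfolded has_vector_derivative_prod_iff]
  note P_fst = P_deriv[THEN conjunct1] and P_snd = P_deriv[THEN conjunct2]
  have g1: "\<bar>fst (g \<theta>)\<bar> \<le> w / 4" and g2: "\<bar>snd (g \<theta>)\<bar> \<le> w / 4" for \<theta>
    using g abs_fst_le_norm abs_snd_le_norm order_trans by blast+
  have "\<bar>snd (P \<theta>)\<bar> \<le> (w / 4) / \<bar>lam\<bar>" for \<theta>
    by (rule linear_ode_bound[OF P_snd _ P'(4)]) (use P'(1) g2 \<open>lam < 0\<close> in auto)
  then have s: "\<bar>lam * snd (P \<theta>)\<bar> \<le> w / 4" for \<theta>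
    using \<open>lam < 0\<close> pos_le_divide_eq[of "\<bar>lam\<bar>" "\<bar>snd (P \<theta>)\<bar>" "w / 4"]
    by (simp only: abs_mult mult.commute)
  have low: "3 / 4 * w * \<bar>a\<bar> \<le> \<bar>\<omega> * a\<bar>" for a
  proof -
    have "3 / 4 * w \<le> \<bar>\<omega>\<bar>"
      using freq by linarith
    then show ?thesis
      unfolding abs_mult by (rule mult_right_mono) simp
  qed
  have P'3: "norm (P' \<theta>) \<le> 3" for \<theta>
  proof -
    have "3 / 4 * w * (\<bar>fst (P' \<theta>)\<bar> + \<bar>snd (P' \<theta>)\<bar>) \<le> \<bar>w + fst (g \<theta>)\<bar> + \<bar>lam * snd (P \<theta>) + snd (g \<theta>)\<bar>"
      using low[of "fst (P' \<theta>)"] low[of "snd (P' \<theta>)"] P'(3,4)[of \<theta>] by (simp add: distrib_left)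
    also have "\<dots> \<le> 3 / 4 * w * 3"
      using g1[of \<theta>] g2[of \<theta>] s[of \<theta>] \<open>w > 0\<close> by linarith
    finally have "\<bar>fst (P' \<theta>)\<bar> + \<bar>snd (P' \<theta>)\<bar> \<le> 3"
      using \<open>w > 0\<close> by simp
    with norm_le_abs_sum[of "P' \<theta>"] show ?thesis
      by linarith
  qed
  show ?thesis
    using P'3[of t] vector_derivative_unique_at[OF v P'(2)[of t]] by simp
qed

lemma forced_solution_lipschitz:
  assumes "forced_solution w lam \<omega> P g" "\<And>\<theta>. norm (g \<theta>) \<le> w / 4" "lam < 0" "w > 0"
  shows "norm (P x - P y) \<le> 3 * \<bar>x - y\<bar>"
proof -
  obtain P' where P': "\<And>\<theta>. (P has_vector_derivative P' \<theta>) (at \<theta>)"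
    using assms(1) unfolding forced_solution_def by blast
  have "onorm (\<lambda>h. h *\<^sub>R P' \<theta>) \<le> 3" for \<theta>
    using forced_solution_derivative_bound[OF assms(1,2) P' assms(3,4), of \<theta>]
    by (intro onorm_bound) (auto simp: mult.commute mult_left_mono)
  then show ?thesis
    using differentiable_bound[of UNIV P "\<lambda>\<theta> h. h *\<^sub>R P' \<theta>" 3 x y] P'
    by (simp add: has_vector_derivative_def)
qed

text \<open>
  The difference of two solutions solves the same equation with a forcing of size \<open>4 c\<close>. Its first
  component is integrated from \<open>0\<close>, where it vanishes; the second obeys the maximum principle.
\<close>

lemma forced_solution_diff:
  assumes P: "forced_solution w lam \<omega> P g" and Q: "forced_solution w lam \<omega>' Q k"
    and c: "\<And>\<theta>. norm (g \<theta> - k \<theta>) \<le> c" and "lam < 0" "w > 0" "\<omega> \<ge> w / 2"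
    and k: "\<And>\<theta>. norm (k \<theta>) \<le> w / 4"
    and phase: "fst (P 0) = fst (Q 0)"
  shows "norm (P \<theta> - Q \<theta>) \<le> (8 / w + 4 / \<bar>lam\<bar>) * c"
proof -
  obtain P' where P': "\<And>\<theta>. P (\<theta> + 1) = P \<theta> + (1, 0)"
    "\<And>\<theta>. (P has_vector_derivative P' \<theta>) (at \<theta>)"
    "\<And>\<theta>. \<omega> * fst (P' \<theta>) = w + fst (g \<theta>)"
    "\<And>\<theta>. \<omega> * snd (P' \<theta>) = lam * snd (P \<theta>) + snd (g \<theta>)"
    by (rule forced_solutionE[OF P]) (rule that)
  note P_deriv = P'(2)[unfolded has_vector_derivative_prod_iff]
  note P_fst = P_deriv[THEN conjunct1] and P_snd = P_deriv[THEN conjunct2]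
  obtain Q' where Q': "\<And>\<theta>. Q (\<theta> + 1) = Q \<theta> + (1, 0)"
    "\<And>\<theta>. (Q has_vector_derivative Q' \<theta>) (at \<theta>)"
    "\<And>\<theta>. \<omega>' * fst (Q' \<theta>) = w + fst (k \<theta>)"
    "\<And>\<theta>. \<omega>' * snd (Q' \<theta>) = lam * snd (Q \<theta>) + snd (k \<theta>)"
    by (rule forced_solutionE[OF Q]) (rule that)
  note Q_deriv = Q'(2)[unfolded has_vector_derivative_prod_iff]
  note Q_fst = Q_deriv[THEN conjunct1] and Q_snd = Q_deriv[THEN conjunct2]
  have "c \<ge> 0"
    using c[of 0] norm_ge_zero order_trans by blast
  have Q'3: "norm (Q' x) \<le> 3" for x
    by (rule forced_solution_derivative_bound[OF Q k Q'(2) \<open>lam < 0\<close> \<open>w > 0\<close>])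
  have freq: "\<bar>\<omega> - \<omega>'\<bar> \<le> c"
    by (rule frequency_diff[OF P Q c])
  \<comment> \<open>Subtracting equations with different frequencies leaves the term
    \<open>(\<omega> - \<omega>') *\<^sub>R Q' x\<close>, which counts as additional forcing. The
    slope bound 3 for \<open>Q\<close> makes each of its components at most \<open>3 * c\<close>;
    with \<open>g - k\<close> this gives \<open>4 * c\<close>.\<close>
  have prod: "\<bar>(\<omega> - \<omega>') * a\<bar> \<le> c * 3" if "\<bar>a\<bar> \<le> norm (Q' x)" for a x
    unfolding abs_mult using freq that Q'3[of x] by (intro mult_mono) auto
  define d where "d = (\<lambda>\<theta>. P \<theta> - Q \<theta>)"
  have d1: "((\<lambda>x. fst (d x)) has_real_derivative fst (P' x) - fst (Q' x)) (at x)"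
    and d2: "((\<lambda>x. snd (d x)) has_real_derivative snd (P' x) - snd (Q' x)) (at x)" for x
    unfolding d_def by (auto intro!: derivative_eq_intros P_fst P_snd Q_fst Q_snd)
  have d_per: "d (x + 1) = d x" for x
    by (simp add: d_def P'(1) Q'(1))
  have "\<bar>fst (P' x) - fst (Q' x)\<bar> \<le> 8 * c / w" for x
  proof -
    have "\<omega> * (fst (P' x) - fst (Q' x)) = fst (g x - k x) - (\<omega> - \<omega>') * fst (Q' x)"
      using P'(3)[of x] Q'(3)[of x] by (simp add: algebra_simps)
    then have "\<bar>\<omega> * (fst (P' x) - fst (Q' x))\<bar> \<le> 4 * c"
      using prod[OF abs_fst_le_norm[of "Q' x"]] c[of x] abs_fst_le_norm[of "g x - k x"] by linarith
    moreover have "w / 2 * \<bar>fst (P' x) - fst (Q' x)\<bar> \<le> \<bar>\<omega> * (fst (P' x) - fst (Q' x))\<bar>"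
      unfolding abs_mult using assms(5,6) by (intro mult_right_mono) auto
    ultimately show ?thesis
      using \<open>w > 0\<close> by (simp add: field_simps)
  qed
  then have inc: "\<bar>fst (d x) - fst (d 0)\<bar> \<le> 8 * c / w * \<bar>x - 0\<bar>" for x
    by (rule increment_bound[OF d1])
  have f: "\<bar>fst (d \<theta>)\<bar> \<le> 8 * c / w"
  proof (rule periodic_le[of "\<lambda>x. \<bar>fst (d x)\<bar>"])
    fix x :: real assume "x \<in> {0..1}"
    then have "8 * c / w * \<bar>x - 0\<bar> \<le> 8 * c / w * 1"
      using \<open>c \<ge> 0\<close> \<open>w > 0\<close> by (intro mult_left_mono) auto
    moreover have "fst (d 0) = 0"
      by (simp add: d_def phase)
    ultimately show "\<bar>fst (d x)\<bar> \<le> 8 * c / w"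
      using inc[of x] by simp
  qed (simp add: d_per)
  have s: "\<bar>snd (d \<theta>)\<bar> \<le> (4 * c) / \<bar>lam\<bar>"
  proof (rule linear_ode_bound[OF d2, of \<omega> lam "\<lambda>x. snd (g x - k x) - (\<omega> - \<omega>') * snd (Q' x)"])
    show "\<omega> * (snd (P' x) - snd (Q' x)) = lam * snd (d x) + (snd (g x - k x) - (\<omega> - \<omega>') * snd (Q' x))" for x
      using P'(4)[of x] Q'(4)[of x] by (simp add: d_def algebra_simps)
    show "\<bar>snd (g x - k x) - (\<omega> - \<omega>') * snd (Q' x)\<bar> \<le> 4 * c" for x
      using prod[OF abs_snd_le_norm[of "Q' x"]] c[of x] abs_snd_le_norm[of "g x - k x"] by linarith
  qed (use d_per \<open>lam < 0\<close> in auto)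
  show ?thesis
    using f s norm_le_abs_sum[of "d \<theta>"] by (simp add: d_def distrib_right)
qed

lemma forced_solution_exists:
  assumes g: "continuous_on UNIV g" "\<And>x. g (x + 1) = g x" "\<And>x. norm (g x) \<le> w / 4"
    and "lam < 0" "w > 0"
  obtains \<omega> P where "forced_solution w lam \<omega> P g" "fst (P 0) = 0"
proof -
  obtain F where F: "\<And>x. (F has_real_derivative fst (g x)) (at x)"
    by (rule antiderivative_exists[of "\<lambda>x. fst (g x)"]) (use g in \<open>auto intro!: continuous_intros\<close>)
  have F_shift: "F (x + 1) - F x = F 1 - F 0" for x
  proof -
    have "((\<lambda>x. F (x + 1)) has_real_derivative fst (g x)) (at x)" for x
      using F[of "x + 1"] g(2) by (simp add: DERIV_shift)
    then show ?thesis
      using DERIV_isconst_all[of "\<lambda>x. F (x + 1) - F x" x 0] DERIV_diff[OF _ F] by fastforce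
  qed
  \<comment> \<open>The only frequency for which the first component, with derivative
    \<open>(w + fst (g x)) / \<omega>\<close>, gains exactly 1 over a period.\<close>
  define \<omega> where "\<omega> = w + (F 1 - F 0)"
  have "\<bar>F 1 - F 0\<bar> \<le> w / 4 * \<bar>1 - 0\<bar>"
    using g(3) abs_fst_le_norm order_trans by (intro increment_bound[OF F]) blast
  then have \<omega>: "\<omega> > 0"
    using \<open>w > 0\<close> unfolding \<omega>_def by (simp add: abs_if split: if_splits)
  obtain p p' where p: "\<And>x. (p has_real_derivative p' x) (at x)" "\<And>x. p (x + 1) = p x"
    "\<And>x. \<omega> * p' x = lam * p x + snd (g x)"
    using linear_ode_periodic_solution[of "\<lambda>x. snd (g x)" lam \<omega>] g \<omega> \<open>lam < 0\<close>
    by (auto intro: continuous_on_snd)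
  define P where "P = (\<lambda>x. ((w * x + F x - F 0) / \<omega>, p x))"
  show ?thesis
  proof
    have "w * (x + 1) + F (x + 1) - F 0 = (w * x + F x - F 0) + \<omega>" for x
      using F_shift[of x] by (simp add: \<omega>_def algebra_simps)
    then have "(w * (x + 1) + F (x + 1) - F 0) / \<omega> = (w * x + F x - F 0) / \<omega> + 1" for x
      using \<omega> by (simp only: add_divide_distrib) simp
    then have "circle_lift P"
      by (simp add: circle_lift_def P_def p)
    moreover have "(P has_vector_derivative ((w + fst (g \<theta>)) / \<omega>, p' \<theta>)) (at \<theta>)" for \<theta>
      unfolding has_vector_derivative_prod_iff P_def using \<omega>
      by (auto intro!: derivative_eq_intros F p)
    moreover have "\<omega> *\<^sub>R ((w + fst (g \<theta>)) / \<omega>, p' \<theta>) = (w, lam * snd (P \<theta>)) + g \<theta>" for \<theta>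
      using \<omega> p(3)[of \<theta>] by (simp add: P_def prod_eq_iff)
    ultimately show "forced_solution w lam \<omega> P g"
      unfolding forced_solution_def
      by (intro conjI exI[of _ "\<lambda>\<theta>. ((w + fst (g \<theta>)) / \<omega>, p' \<theta>)"]) auto
    show "fst (P 0) = 0"
      by (simp add: P_def)
  qed
qed

section \<open>Curves of class \<open>C\<^sup>n\<close> and their compositions\<close>

text \<open>Regularity as a recursion on the existence of a derivative: closure under products,
  pairs and compositions becomes a one-step induction, in any normed target space. It is translated
  into iterated \<open>deriv\<close> only at the end.\<close>

primrec cont_diff :: "nat \<Rightarrow> (real \<Rightarrow> 'a::real_normed_vector) \<Rightarrow> bool" where
  "cont_diff 0 f \<longleftrightarrow> continuous_on UNIV f"
| "cont_diff (Suc n) f \<longleftrightarrow>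
    (\<exists>f'. (\<forall>x. (f has_vector_derivative f' x) (at x)) \<and> cont_diff n f')"

lemma cont_diff_SucI:
  "(\<And>x. (f has_vector_derivative f' x) (at x)) \<Longrightarrow> cont_diff n f' \<Longrightarrow> cont_diff (Suc n) f"
  by auto

lemma cont_diff_SucE:
  assumes "cont_diff (Suc n) f"
  obtains f' where "\<And>x. (f has_vector_derivative f' x) (at x)" "cont_diff n f'"
  using assms by auto

lemma cont_diff_imp_continuous: "cont_diff n f \<Longrightarrow> continuous_on UNIV f"
  by (cases n) (auto intro!: continuous_at_imp_continuous_on intro: has_vector_derivative_continuous)

lemma cont_diff_Suc_imp: "cont_diff (Suc n) f \<Longrightarrow> cont_diff n f"
proof (induction n arbitrary: f)
  case 0
  then show ?case
    using cont_diff_imp_continuous[OF 0] by simp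
next
  case (Suc n)
  obtain f' where f': "\<And>x. (f has_vector_derivative f' x) (at x)" "cont_diff (Suc n) f'"
    using Suc.prems by (rule cont_diff_SucE) (rule that)
  show ?case
    by (rule cont_diff_SucI[OF f'(1) Suc.IH[OF f'(2)]])
qed

lemma cont_diff_const [simp]: "cont_diff n (\<lambda>x. c)"
  by (induction n arbitrary: c) (auto intro!: exI[of _ "\<lambda>x. 0"])

lemma cont_diff_ident [simp]: "cont_diff n (\<lambda>x. x)"
  by (cases n) (auto intro!: exI[of _ "\<lambda>x. 1"])

lemma cont_diff_add: "cont_diff n f \<Longrightarrow> cont_diff n g \<Longrightarrow> cont_diff n (\<lambda>x. f x + g x)"
proof (induction n arbitrary: f g)
  case (Suc n)
  obtain f' where f': "\<And>x. (f has_vector_derivative f' x) (at x)" "cont_diff n f'"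
    using Suc.prems(1) by (rule cont_diff_SucE) (rule that)
  obtain g' where g': "\<And>x. (g has_vector_derivative g' x) (at x)" "cont_diff n g'"
    using Suc.prems(2) by (rule cont_diff_SucE) (rule that)
  show ?case
    by (rule cont_diff_SucI[of _ "\<lambda>x. f' x + g' x"])
       (auto intro: has_vector_derivative_add f' g' Suc.IH)
qed (auto intro: continuous_intros)

lemma cont_diff_sum:
  "finite I \<Longrightarrow> (\<And>i. i \<in> I \<Longrightarrow> cont_diff n (f i)) \<Longrightarrow> cont_diff n (\<lambda>x. \<Sum>i\<in>I. f i x)"
  by (induction rule: finite_induct) (auto intro: cont_diff_add)

lemma cont_diff_linear:
  assumes "bounded_linear T"
  shows "cont_diff n f \<Longrightarrow> cont_diff n (\<lambda>x. T (f x))"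
proof (induction n arbitrary: f)
  case (Suc n)
  obtain f' where f': "\<And>x. (f has_vector_derivative f' x) (at x)" "cont_diff n f'"
    using Suc.prems by (rule cont_diff_SucE) (rule that)
  show ?case
    by (rule cont_diff_SucI[of _ "\<lambda>x. T (f' x)"])
       (auto intro: bounded_linear.has_vector_derivative[OF assms] f' Suc.IH)
qed (auto intro: bounded_linear.continuous_on[OF assms])

lemma cont_diff_scaleR:
  fixes f :: "real \<Rightarrow> real"
  shows "cont_diff n f \<Longrightarrow> cont_diff n g \<Longrightarrow> cont_diff n (\<lambda>x. f x *\<^sub>R g x)"
proof (induction n arbitrary: f g)
  case (Suc n)
  obtain f' where f': "\<And>x. (f has_vector_derivative f' x) (at x)" "cont_diff n f'"
    using Suc.prems(1) by (rule cont_diff_SucE) (rule that)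
  obtain g' where g': "\<And>x. (g has_vector_derivative g' x) (at x)" "cont_diff n g'"
    using Suc.prems(2) by (rule cont_diff_SucE) (rule that)
  show ?case
  proof (rule cont_diff_SucI)
    show "((\<lambda>x. f x *\<^sub>R g x) has_vector_derivative (f x *\<^sub>R g' x + f' x *\<^sub>R g x)) (at x)" for x
      using f'(1) g'(1)
      by (intro has_vector_derivative_scaleR) (auto simp: has_real_derivative_iff_has_vector_derivative)
    show "cont_diff n (\<lambda>x. f x *\<^sub>R g' x + f' x *\<^sub>R g x)"
      by (intro cont_diff_add Suc.IH f' g' Suc.prems[THEN cont_diff_Suc_imp])
  qed
qed (auto intro: continuous_intros)

lemma cont_diff_Pair: "cont_diff n f \<Longrightarrow> cont_diff n g \<Longrightarrow> cont_diff n (\<lambda>x. (f x, g x))"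
proof (induction n arbitrary: f g)
  case (Suc n)
  obtain f' where f': "\<And>x. (f has_vector_derivative f' x) (at x)" "cont_diff n f'"
    using Suc.prems(1) by (rule cont_diff_SucE) (rule that)
  obtain g' where g': "\<And>x. (g has_vector_derivative g' x) (at x)" "cont_diff n g'"
    using Suc.prems(2) by (rule cont_diff_SucE) (rule that)
  show ?case
    by (rule cont_diff_SucI[of _ "\<lambda>x. (f' x, g' x)"])
       (auto intro: has_vector_derivative_Pair f' g' Suc.IH)
qed (auto intro: continuous_intros)

lemma cont_diff_compose:
  fixes g :: "real \<Rightarrow> real"
  shows "cont_diff n f \<Longrightarrow> cont_diff n g \<Longrightarrow> cont_diff n (\<lambda>x. f (g x))"
proof (induction n arbitrary: f)
  case (Suc n)
  obtain f' where f': "\<And>x. (f has_vector_derivative f' x) (at x)" "cont_diff n f'"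
    using Suc.prems(1) by (rule cont_diff_SucE) (rule that)
  obtain g' where g': "\<And>x. (g has_vector_derivative g' x) (at x)" "cont_diff n g'"
    using Suc.prems(2) by (rule cont_diff_SucE) (rule that)
  show ?case
  proof (rule cont_diff_SucI)
    show "((\<lambda>x. f (g x)) has_vector_derivative (g' x *\<^sub>R f' (g x))) (at x)" for x
      using vector_diff_chain_at[OF g'(1) f'(1)] by (simp add: o_def)
    show "cont_diff n (\<lambda>x. g' x *\<^sub>R f' (g x))"
      by (intro cont_diff_scaleR Suc.IH f' g' Suc.prems[THEN cont_diff_Suc_imp])
  qed
qed (auto intro: continuous_on_compose2)

text \<open>Only finitely many derivatives \<open>D (b # vs)\<close>, with \<open>b\<close> a basis vector, enter the chain rule.\<close>

lemma cont_diff_derivative_family: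
  fixes \<gamma> :: "real \<Rightarrow> 'a::euclidean_space"
  assumes D: "derivative_family D f S" and \<gamma>_in: "\<And>x. \<gamma> x \<in> S"
  shows "cont_diff n \<gamma> \<Longrightarrow> cont_diff n (\<lambda>x. D vs (\<gamma> x))"
proof (induction n arbitrary: vs)
  case 0
  have "continuous_on S (D vs)"
    using D unfolding derivative_family_def
    by (meson has_derivative_continuous continuous_on_eq_continuous_within)
  with 0 show ?case
    using \<gamma>_in by (auto intro: continuous_on_compose2)
next
  case (Suc n)
  obtain \<gamma>' where \<gamma>': "\<And>x. (\<gamma> has_vector_derivative \<gamma>' x) (at x)" "cont_diff n \<gamma>'"
    using Suc.prems by (rule cont_diff_SucE) (rule that)
  have der: "(D vs has_derivative (\<lambda>v. D (v # vs) (\<gamma> x))) (at (\<gamma> x) within S)" for x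
    using D \<gamma>_in unfolding derivative_family_def by blast
  have expand: "D (\<gamma>' x # vs) (\<gamma> x) = (\<Sum>b\<in>Basis. (\<gamma>' x \<bullet> b) *\<^sub>R D (b # vs) (\<gamma> x))" for x
  proof -
    interpret T: bounded_linear "\<lambda>v. D (v # vs) (\<gamma> x)"
      using der by (rule has_derivative_bounded_linear)
    have "D (\<gamma>' x # vs) (\<gamma> x) = D ((\<Sum>b\<in>Basis. (\<gamma>' x \<bullet> b) *\<^sub>R b) # vs) (\<gamma> x)"
      by (simp add: euclidean_representation)
    then show ?thesis
      by (simp add: T.sum T.scaleR)
  qed
  show ?case
  proof (rule cont_diff_SucI)
    show "((\<lambda>x. D vs (\<gamma> x)) has_vector_derivative D (\<gamma>' x # vs) (\<gamma> x)) (at x)" for x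
    proof -
      interpret T: bounded_linear "\<lambda>v. D (v # vs) (\<gamma> x)"
        using der by (rule has_derivative_bounded_linear)
      \<comment> \<open>The derivative exists only within \<open>S\<close>, and the curve may run in
        the boundary of \<open>S\<close>, as it does for the half-space \<epsilon> \<ge> 0 at
        \<epsilon> = 0. Restricting to the range of the curve is enough for the chain rule.\<close>
      have "(D vs has_derivative (\<lambda>v. D (v # vs) (\<gamma> x))) (at (\<gamma> x) within range \<gamma>)"
        using der \<gamma>_in by (auto intro: has_derivative_subset)
      from diff_chain_within[OF \<gamma>'(1)[unfolded has_vector_derivative_def] this]
      show ?thesis
        by (simp add: has_vector_derivative_def o_def T.scaleR)
    qed
    show "cont_diff n (\<lambda>x. D (\<gamma>' x # vs) (\<gamma> x))"
      unfolding expand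
      by (intro cont_diff_sum cont_diff_scaleR Suc.IH Suc.prems[THEN cont_diff_Suc_imp]
          cont_diff_linear[OF bounded_linear_inner_left] \<gamma>'(2) finite_Basis)
  qed
qed

lemma cont_diff_real_deriv:
  fixes g :: "real \<Rightarrow> real"
  assumes "cont_diff n g"
  shows "(\<forall>k<n. \<forall>x. (deriv ^^ k) g field_differentiable at x) \<and> continuous_on UNIV ((deriv ^^ n) g)"
  using assms
proof (induction n arbitrary: g)
  case (Suc n)
  obtain g' where "\<And>x. (g has_vector_derivative g' x) (at x)" "cont_diff n g'"
    using Suc.prems by (rule cont_diff_SucE) (rule that)
  then have g': "\<And>x. (g has_real_derivative g' x) (at x)" "cont_diff n g'"
    by (auto simp: has_real_derivative_iff_has_vector_derivative)
  have "deriv g = g'"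
    by (intro ext DERIV_imp_deriv g')
  then have s: "(deriv ^^ Suc k) g = (deriv ^^ k) g'" for k
    by (simp add: funpow_swap1)
  have "(deriv ^^ k) g field_differentiable at x" if "k < Suc n" for k x
  proof (cases k)
    case 0
    then show ?thesis
      using g'(1) by (auto simp: field_differentiable_def)
  next
    case (Suc j)
    show ?thesis
      unfolding Suc s using that Suc Suc.IH[OF g'(2)] by simp
  qed
  moreover have "continuous_on UNIV ((deriv ^^ Suc n) g)"
    using Suc.IH[OF g'(2)] unfolding s by blast
  ultimately show ?case
    by blast
qed auto

lemma cont_diff_imp_C_class: "cont_diff n W \<Longrightarrow> C_class n W"
  using cont_diff_real_deriv[OF cont_diff_linear[OF bounded_linear_fst], of n W]
    cont_diff_real_deriv[OF cont_diff_linear[OF bounded_linear_snd], of n W]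
  by (simp add: C_class_def o_def)

section \<open>Interpolation of derivatives\<close>

text \<open>The mean value theorem at scale \<open>h\<close> gives \<open>\<bar>f' x\<bar> \<le> 2 a / h + c h\<close>; take \<open>h = 4 a / \<bar>f' x\<bar>\<close>.\<close>

lemma landau_inequality:
  fixes f :: "real \<Rightarrow> real"
  assumes f: "\<And>x. (f has_real_derivative f' x) (at x)" and f': "\<And>x. (f' has_real_derivative f'' x) (at x)"
    and a: "\<And>x. \<bar>f x\<bar> \<le> a" and c: "\<And>x. \<bar>f'' x\<bar> \<le> c"
  shows "(f' x)\<^sup>2 \<le> 8 * a * c"
proof -
  have nonneg: "a \<ge> 0" "c \<ge> 0"
    using a[of 0] c[of 0] by linarith+
  show ?thesis
  proof (cases "f' x = 0 \<or> a = 0")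
    case True
    moreover have "f' x = 0" if "a = 0"
    proof -
      have "f = (\<lambda>x. 0)"
        using a that by auto
      then show ?thesis
        using DERIV_unique[OF f[of x], of 0] by simp
    qed
    ultimately show ?thesis
      using nonneg by auto
  next
    case False
    define m where "m = \<bar>f' x\<bar>"
    define h where "h = 4 * a / m"
    have m: "m > 0" and "a > 0"
      using False nonneg by (auto simp: m_def)
    then have h: "h > 0" "h * m = 4 * a"
      by (auto simp: h_def)
    obtain z where z: "x < z" "z < x + h" "f (x + h) - f x = (x + h - x) * f' z"
      using MVT2[of x "x + h" f f'] f h(1) by auto
    have "\<bar>f' z - f' x\<bar> \<le> c * \<bar>z - x\<bar>"
      using field_differentiable_bound[of UNIV f' f'' c z x] f' c by simp
    also have "\<dots> \<le> c * h"
      using z nonneg by (intro mult_left_mono) auto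
    finally have "m \<le> \<bar>f' z\<bar> + c * h"
      unfolding m_def by linarith
    then have "h * m \<le> h * (\<bar>f' z\<bar> + c * h)"
      using h(1) by (intro mult_left_mono) auto
    moreover have "h * \<bar>f' z\<bar> \<le> 2 * a"
    proof -
      have "h * \<bar>f' z\<bar> = \<bar>f (x + h) - f x\<bar>"
        using z(3) h(1) by (simp add: abs_mult)
      then show ?thesis
        using a[of "x + h"] a[of x] by linarith
    qed
    ultimately have "2 * a \<le> c * h * h"
      using h(2) by (simp add: algebra_simps)
    then have "2 * a * m\<^sup>2 \<le> c * (h * m)\<^sup>2"
      using mult_right_mono[of "2 * a" "c * h * h" "m\<^sup>2"] by (simp add: power2_eq_square mult_ac)
    then have "a * m\<^sup>2 \<le> a * (8 * a * c)"
      unfolding h(2) by (simp add: power2_eq_square mult_ac)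
    then have "m\<^sup>2 \<le> 8 * a * c"
      using \<open>a > 0\<close> mult_le_cancel_left_pos by blast
    then show ?thesis
      by (simp add: m_def)
  qed
qed

text \<open>The ratios \<open>z k = s k / \<beta> k\<close> satisfy
  \<open>(z j)\<^sup>2 \<le> z (j - 1) * z (j + 1)\<close> at interior indices. If their maximum
  exceeded 1, it would be attained at an interior index; at the leftmost such index the left
  neighbour is strictly smaller and the right one no larger, a contradiction. Ratios replace
  logarithms because \<open>s\<close> may vanish.\<close>

lemma log_convex_max_principle:
  fixes s \<beta> :: "nat \<Rightarrow> real"
  assumes \<beta>: "\<And>k. \<beta> k > 0"
    and sk: "\<And>k. Suc k < L \<Longrightarrow> (s (Suc k))\<^sup>2 \<le> 8 * s k * s (Suc (Suc k))"
    and \<beta>k: "\<And>k. Suc k < L \<Longrightarrow> (\<beta> (Suc k))\<^sup>2 = 8 * \<beta> k * \<beta> (Suc (Suc k))"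
    and s: "\<And>k. s k \<ge> 0" "s 0 \<le> \<beta> 0" "s L \<le> \<beta> L" and "k \<le> L"
  shows "s k \<le> \<beta> k"
proof (rule ccontr)
  assume "\<not> s k \<le> \<beta> k"
  define z where "z = (\<lambda>k. s k / \<beta> k)"
  define m where "m = Max (z ` {..L})"
  have max: "z j \<le> m" if "j \<le> L" for j
    unfolding m_def using that by (intro Max_ge) auto
  have "1 < z k"
    using \<open>\<not> s k \<le> \<beta> k\<close> \<beta>[of k] by (simp add: z_def field_simps)
  then have "1 < m"
    using max[OF \<open>k \<le> L\<close>] by linarith
  have "m \<in> z ` {..L}"
    unfolding m_def by (intro Max_in) auto
  then have ex: "\<exists>j. j \<le> L \<and> z j = m"
    by auto
  define j where "j = (LEAST j. j \<le> L \<and> z j = m)"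
  have j: "j \<le> L" "z j = m"
    using LeastI_ex[OF ex] by (auto simp: j_def)
  have least: "z i \<noteq> m" if "i < j" "i \<le> L" for i
    using not_less_Least[of i "\<lambda>j. j \<le> L \<and> z j = m"] that by (auto simp: j_def)
  have "z 0 \<le> 1" "z L \<le> 1"
    using s \<beta>[of 0] \<beta>[of L] by (auto simp: z_def field_simps)
  with j \<open>1 < m\<close> have "j \<noteq> 0" "j \<noteq> L"
    by (metis not_le)+
  then obtain i where i: "j = Suc i" "Suc i < L"
    using j(1) by (cases j) auto
  have "z i < m"
    using max[of i] least[of i] i by simp
  have "(s j)\<^sup>2 / (\<beta> j)\<^sup>2 \<le> (8 * s i * s (Suc j)) / (\<beta> j)\<^sup>2"
    using sk[OF i(2)] i(1) by (intro divide_right_mono) auto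
  also have "\<dots> = z i * z (Suc j)"
    using \<beta>k[OF i(2)] i(1) by (simp add: z_def)
  also have "(s j)\<^sup>2 / (\<beta> j)\<^sup>2 = m\<^sup>2"
    by (subst j(2)[symmetric]) (simp add: z_def power_divide)
  finally have "m\<^sup>2 \<le> z i * z (Suc j)" .
  also have "\<dots> \<le> z i * m"
    using max[of "Suc j"] i s(1)[of i] \<beta>[of i] by (intro mult_left_mono) (auto simp: z_def)
  also have "\<dots> < m * m"
    using \<open>z i < m\<close> \<open>1 < m\<close> by simp
  finally show False
    by (simp add: power2_eq_square)
qed

text \<open>
  The weights \<open>8\<^sup>k\<^sup>(\<^sup>L\<^sup>-\<^sup>k\<^sup>)\<^sup>/\<^sup>2\<close> turn the recursion \<open>s\<^sub>k\<^sup>2 \<le> 8 s\<^sub>k\<^sub>-\<^sub>1 s\<^sub>k\<^sub>+\<^sub>1\<close> of Landau's inequality into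
  logarithmic convexity.
\<close>

lemma derivative_interpolation:
  fixes f :: "nat \<Rightarrow> real \<Rightarrow> real"
  assumes "L > 0" and f: "\<And>k x. k < L \<Longrightarrow> (f k has_real_derivative f (Suc k) x) (at x)"
    and A: "\<And>x. \<bar>f 0 x\<bar> \<le> A" "A > 0" and N: "\<And>k x. k \<le> L \<Longrightarrow> \<bar>f k x\<bar> \<le> N" "N > 0" and "k \<le> L"
  shows "\<bar>f k x\<bar> \<le> 8 ^ (L * L) * A powr (1 - real k / real L) * N powr (real k / real L)"
proof -
  \<comment> \<open>The value 0 beyond \<open>L\<close> is a default that keeps \<open>s\<close>
    nonnegative at every index, as the maximum principle asks.\<close>
  define s where "s k = (if k \<le> L then SUP x. \<bar>f k x\<bar> else 0)" for k
  \<comment> \<open>The logarithm of the comparison sequence: linear interpolation between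
    \<open>ln A\<close> and \<open>ln N\<close>, plus a quadratic term whose second difference is
    \<open>- ln 8\<close> and which vanishes at both ends.\<close>
  define q where "q k = ln 8 * (real k * (real L - real k) / 2) + ln A * (1 - real k / real L) + ln N * (real k / real L)"
    for k
  have upper: "\<bar>f k x\<bar> \<le> s k" if "k \<le> L" for k x
    unfolding s_def using N(1)[OF that] that by (auto intro!: cSUP_upper bdd_aboveI2)
  have s_nonneg: "s j \<ge> 0" for j
    using upper[of j 0] by (cases "j \<le> L") (auto simp: s_def)
  have "s k \<le> exp (q k)"
  proof (rule log_convex_max_principle[of "\<lambda>k. exp (q k)" L])
    show "s j \<ge> 0" for j
      by (rule s_nonneg)
    show "s 0 \<le> exp (q 0)"
      using A by (auto simp: s_def q_def intro!: cSUP_least)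
    show "s L \<le> exp (q L)"
      using N \<open>L > 0\<close> by (auto simp: s_def q_def intro!: cSUP_least)
    show "(s (Suc j))\<^sup>2 \<le> 8 * s j * s (Suc (Suc j))" if j: "Suc j < L" for j
    proof -
      have *: "\<bar>f (Suc j) x\<bar> \<le> sqrt (8 * s j * s (Suc (Suc j)))" for x
        using landau_inequality[of "f j" "f (Suc j)" "f (Suc (Suc j))" "s j" "s (Suc (Suc j))" x] f j upper
        by (auto intro!: real_le_rsqrt)
      have "s (Suc j) \<le> sqrt (8 * s j * s (Suc (Suc j)))"
        using j * unfolding s_def[of "Suc j"] by (auto intro!: cSUP_least)
      then show ?thesis
        using power_mono[of "s (Suc j)" "sqrt (8 * s j * s (Suc (Suc j)))" 2] s_nonneg by simp
    qed
    show "(exp (q (Suc j)))\<^sup>2 = 8 * exp (q j) * exp (q (Suc (Suc j)))" for j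
    proof -
      have "2 * q (Suc j) = ln 8 + q j + q (Suc (Suc j))"
        using \<open>L > 0\<close> by (simp add: q_def field_simps)
      then have "exp (2 * q (Suc j)) = exp (ln 8 + q j + q (Suc (Suc j)))"
        by simp
      then show ?thesis
        by (simp add: exp_add exp_double[symmetric])
    qed
  qed (use \<open>k \<le> L\<close> in auto)
  also have "exp (q k) = exp (ln 8 * (real k * (real L - real k) / 2)) * A powr (1 - real k / real L) * N powr (real k / real L)"
    using A N by (simp add: q_def exp_add powr_def mult.commute)
  also have "\<dots> \<le> 8 ^ (L * L) * A powr (1 - real k / real L) * N powr (real k / real L)"
  proof (intro mult_right_mono)
    have "real k * (real L - real k) \<le> real L * real L"
      using \<open>k \<le> L\<close> by (intro mult_mono) auto
    moreover have "0 \<le> real L * real L"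
      by simp
    ultimately have "real k * (real L - real k) / 2 \<le> real (L * L)"
      unfolding of_nat_mult by linarith
    then have "(8::real) powr (real k * (real L - real k) / 2) \<le> 8 powr real (L * L)"
      by (intro powr_mono) auto
    also have "8 powr real (L * L) = 8 ^ (L * L)"
      by (rule powr_realpow) simp
    also have "8 powr (real k * (real L - real k) / 2) = exp (ln 8 * (real k * (real L - real k) / 2))"
      by (simp add: powr_def)
    finally show "exp (ln 8 * (real k * (real L - real k) / 2)) \<le> 8 ^ (L * L)" .
  qed auto
  finally show ?thesis
    using upper[OF \<open>k \<le> L\<close>] order_trans by blast
qed

text \<open>Replaces the exponent \<open>1 - k / L\<close> by the common exponent
  \<open>1 - l / L\<close> for all \<open>k \<le> l\<close>. This is monotone only for
  \<open>e \<le> 1\<close>, so \<open>e\<close> is truncated to \<open>min e 1\<close>; the bound on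
  \<open>f 0\<close> survives because \<open>\<bar>f 0 x\<bar> \<le> N \<le> K\<close>. The case
  \<open>e = 0\<close> is separate, as the interpolation wants a positive bound: then
  \<open>f 0\<close> and with it all the derivatives vanish.\<close>

lemma derivative_interpolation_error:
  fixes f :: "nat \<Rightarrow> real \<Rightarrow> real"
  assumes f: "\<And>k x. k < L \<Longrightarrow> (f k has_real_derivative f (Suc k) x) (at x)"
    and e: "\<And>x. \<bar>f 0 x\<bar> \<le> K * e" "e \<ge> 0" and N: "\<And>k x. k \<le> L \<Longrightarrow> \<bar>f k x\<bar> \<le> N" "1 \<le> N" "N \<le> K"
    and "k \<le> l" "l < L"
  shows "\<bar>f k x\<bar> \<le> 8 ^ (L * L) * K * N * e powr (1 - real l / real L)"
proof (cases "e = 0")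
  case True
  have "f j = (\<lambda>x. 0)" if "j \<le> L" for j
    using that
  proof (induction j)
    case 0
    then show ?case
      using e(1) True by (intro ext) simp
  next
    case (Suc j)
    then have "f j = (\<lambda>x. 0)" "j < L"
      by simp_all
    then have "((\<lambda>x. 0) has_real_derivative f (Suc j) x) (at x)" for x
      using f[of j x] by simp
    then show ?case
      by (intro ext) (rule DERIV_unique[OF _ DERIV_const])
  qed
  from this[of k] have "f k x = 0"
    using \<open>k \<le> l\<close> \<open>l < L\<close> by simp
  then show ?thesis
    using N(2,3) by simp
next
  case False
  define m where "m = min e 1"
  have m: "m > 0" "m \<le> 1" "m \<le> e"
    using False e(2) by (auto simp: m_def)
  have "\<bar>f 0 x\<bar> \<le> K * m" for x
    using e(1)[of x] N(1)[of 0 x] N(3) unfolding m_def min_def by (cases "e \<le> 1") simp_all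
  moreover have "K * m > 0" "L > 0" "N > 0" "k \<le> L"
    using m N assms by simp_all
  ultimately have "\<bar>f k x\<bar> \<le> 8 ^ (L * L) * (K * m) powr (1 - real k / real L) * N powr (real k / real L)"
    by (intro derivative_interpolation f N(1))
  also have "\<dots> \<le> 8 ^ (L * L) * (K * e powr (1 - real l / real L)) * N"
  proof (intro mult_mono)
    have kl: "0 \<le> 1 - real l / real L" "1 - real l / real L \<le> 1 - real k / real L"
      "1 - real k / real L \<le> 1"
      using assms by (auto simp: field_simps)
    have "K powr (1 - real k / real L) \<le> K powr 1"
      using N kl by (intro powr_mono) auto
    moreover have "m powr (1 - real k / real L) \<le> m powr (1 - real l / real L)"
      using m kl by (intro powr_mono') auto
    moreover have "m powr (1 - real l / real L) \<le> e powr (1 - real l / real L)"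
      using m kl by (intro powr_mono2) auto
    ultimately show "(K * m) powr (1 - real k / real L) \<le> K * e powr (1 - real l / real L)"
      using N m by (simp add: powr_mult mult_mono)
    have "N powr (real k / real L) \<le> N powr 1"
      using N assms by (intro powr_mono) (auto simp: field_simps)
    then show "N powr (real k / real L) \<le> N"
      using N by simp
  qed (use N in auto)
  finally show ?thesis
    by (simp add: mult_ac)
qed

section \<open>Pointwise bounds and the norms over a fundamental domain\<close>

lemma C_class_continuous_deriv:
  assumes "C_class n f" "k \<le> n"
  shows "continuous_on UNIV ((deriv ^^ k) (fst \<circ> f))" "continuous_on UNIV ((deriv ^^ k) (snd \<circ> f))"
proof -
  have "continuous_on UNIV ((deriv ^^ k) g)" if g: "g \<in> {fst \<circ> f, snd \<circ> f}" for g
  proof (cases "k = n")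
    case True
    with assms(1) g show ?thesis
      unfolding C_class_def by blast
  next
    case False
    with assms g have "(deriv ^^ k) g field_differentiable at x" for x
      unfolding C_class_def by (meson le_neq_implies_less)
    then show ?thesis
      by (intro continuous_at_imp_continuous_on ballI field_differentiable_imp_continuous_at)
  qed
  then show "continuous_on UNIV ((deriv ^^ k) (fst \<circ> f))" "continuous_on UNIV ((deriv ^^ k) (snd \<circ> f))"
    by blast+
qed

lemma abs_le_SUP:
  fixes g :: "real \<Rightarrow> real"
  assumes "continuous_on UNIV g" "x \<in> {0..1}"
  shows "\<bar>g x\<bar> \<le> (SUP \<theta>\<in>{0..1}. \<bar>g \<theta>\<bar>)"
proof -
  have "compact ((\<lambda>\<theta>. \<bar>g \<theta>\<bar>) ` {0..1})"
    by (intro compact_continuous_image continuous_intros continuous_on_subset[OF assms(1)]) auto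
  then have "bdd_above ((\<lambda>\<theta>. \<bar>g \<theta>\<bar>) ` {0..1})"
    by (intro bounded_imp_bdd_above compact_imp_bounded)
  then show ?thesis
    using assms(2) by (rule cSUP_upper2) auto
qed

lemma C_norm_ge:
  assumes "C_class n f" "k \<le> n" "x \<in> {0..1}"
  shows "\<bar>(deriv ^^ k) (fst \<circ> f) x\<bar> \<le> C_norm n f" "\<bar>(deriv ^^ k) (snd \<circ> f) x\<bar> \<le> C_norm n f"
proof -
  show "\<bar>(deriv ^^ k) (fst \<circ> f) x\<bar> \<le> C_norm n f"
    unfolding C_norm_def
    by (rule order_trans[OF abs_le_SUP[OF C_class_continuous_deriv(1)[OF assms(1,2)] assms(3)]], rule Max_ge)
       (use assms(2) in auto)
  show "\<bar>(deriv ^^ k) (snd \<circ> f) x\<bar> \<le> C_norm n f"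
    unfolding C_norm_def
    by (rule order_trans[OF abs_le_SUP[OF C_class_continuous_deriv(2)[OF assms(1,2)] assms(3)]], rule Max_ge)
       (use assms(2) in auto)
qed

lemma C_norm_le:
  assumes "\<And>k x. k \<le> n \<Longrightarrow> x \<in> {0..1} \<Longrightarrow> \<bar>(deriv ^^ k) (fst \<circ> f) x\<bar> \<le> c"
    "\<And>k x. k \<le> n \<Longrightarrow> x \<in> {0..1} \<Longrightarrow> \<bar>(deriv ^^ k) (snd \<circ> f) x\<bar> \<le> c"
  shows "C_norm n f \<le> c"
  unfolding C_norm_def
  by (rule Max.boundedI) (use assms in \<open>auto intro!: cSUP_least simp del: comp_apply\<close>)

section \<open>The delay equation\<close>

lemma forced_solution_shift:
  assumes "forced_solution w lam \<omega> P g"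
  shows "forced_solution w lam \<omega> (\<lambda>\<theta>. P (\<theta> + a)) (\<lambda>\<theta>. g (\<theta> + a))"
proof -
  obtain P' where P': "\<And>\<theta>. P (\<theta> + 1) = P \<theta> + (1, 0)"
    "\<And>\<theta>. (P has_vector_derivative P' \<theta>) (at \<theta>)"
    "\<And>\<theta>. \<omega> *\<^sub>R P' \<theta> = (w, lam * snd (P \<theta>)) + g \<theta>"
    using assms unfolding forced_solution_def circle_lift_def by blast
  have "P (\<theta> + 1 + a) = P (\<theta> + a) + (1, 0)" for \<theta>
    using P'(1)[of "\<theta> + a"] by (simp add: add_ac)
  then show ?thesis
    unfolding forced_solution_def circle_lift_def
    by (intro conjI exI[of _ "\<lambda>\<theta>. P' (\<theta> + a)"]) (auto intro: shift_derivative P')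
qed

lemma forced_solution_continuous: "forced_solution w lam \<omega> P g \<Longrightarrow> continuous_on UNIV P"
  unfolding forced_solution_def
  by (blast intro: continuous_at_imp_continuous_on has_vector_derivative_continuous)

lemma circle_lift_bounded_diff:
  assumes "circle_lift V" "continuous_on UNIV V" "circle_lift W" "continuous_on UNIV W"
  obtains b where "b \<ge> 0" "\<And>\<theta>. norm (V \<theta> - W \<theta>) \<le> b"
  by (rule periodic_continuous_bounded[of "\<lambda>\<theta>. V \<theta> - W \<theta>"])
     (use assms that in \<open>auto intro!: continuous_intros simp: circle_lift_def\<close>)

lemma circle_lift_identity: "circle_lift (\<lambda>\<theta>. (\<theta>, 0))"
  by (simp add: circle_lift_def)

text \<open>A lift stays within a bounded distance \<open>b\<close> of the identity, so its first
  component is nonpositive at \<open>- b\<close> and nonnegative at \<open>b\<close>. This brings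
  any solution to the phase normalisation under which uniqueness is proved.\<close>

lemma circle_lift_zero_phase:
  assumes V: "circle_lift V" "continuous_on UNIV V"
  obtains a where "fst (V a) = 0"
proof -
  obtain b where b: "b \<ge> 0" "\<And>\<theta>. norm (V \<theta> - (\<theta>, 0)) \<le> b"
    by (rule circle_lift_bounded_diff[OF V circle_lift_identity])
       (auto intro!: continuous_intros intro: that)
  have fst_b: "\<bar>fst (V \<theta>) - \<theta>\<bar> \<le> b" for \<theta>
    using b(2)[of \<theta>] abs_fst_le_norm[of "V \<theta> - (\<theta>, 0)"] by simp
  have "\<exists>a\<ge>-b. a \<le> b \<and> fst (V a) = 0"
    by (rule IVT') (use b(1) fst_b[of b] fst_b[of "-b"] V(2) in
        \<open>auto intro!: continuous_intros intro: continuous_on_subset\<close>)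
  then show ?thesis
    using that by blast
qed

text \<open>Lifts are unbounded, but their difference from the identity is bounded. Coding a lift by
  this difference makes the supremum distance a complete metric, as Banach's theorem
  requires.\<close>

definition circle_map :: "(real \<Rightarrow>\<^sub>C (real \<times> real)) \<Rightarrow> real \<Rightarrow> real \<times> real" where
  "circle_map V \<theta> = (\<theta>, 0) + apply_bcontfun V \<theta>"

lemma circle_map_exists:
  assumes P: "circle_lift P" "continuous_on UNIV P"
  obtains V where "circle_map V = P"
proof -
  obtain b where "\<And>\<theta>. norm (P \<theta> - (\<theta>, 0)) \<le> b"
    by (rule circle_lift_bounded_diff[OF P circle_lift_identity])
       (auto intro!: continuous_intros intro: that)
  then have "(\<lambda>\<theta>. P \<theta> - (\<theta>, 0)) \<in> bcontfun"
    using P(2) by (intro bcontfun_normI continuous_intros) auto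
  then have "circle_map (Bcontfun (\<lambda>\<theta>. P \<theta> - (\<theta>, 0))) = P"
    by (intro ext) (simp add: circle_map_def Bcontfun_inverse)
  with that show ?thesis .
qed

lemma norm_circle_map_diff: "norm (circle_map V \<theta> - circle_map W \<theta>) \<le> dist V W"
  using dist_bounded[of V \<theta> W] by (simp add: circle_map_def dist_norm)

lemma dist_le_circle_map_diff:
  "(\<And>\<theta>. norm (circle_map V \<theta> - circle_map W \<theta>) \<le> b) \<Longrightarrow> dist V W \<le> b"
  by (rule dist_bound) (simp add: circle_map_def dist_norm)

lemma continuous_circle_map: "continuous_on UNIV (circle_map V)"
  unfolding circle_map_def by (intro continuous_intros continuous_on_apply_bcontfun)

text \<open>Makes pointwise conditions on a curve closed conditions on the pair of frequency and
  curve.\<close>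

lemma continuous_circle_map_eval: "continuous_on UNIV (\<lambda>p. circle_map (snd p) \<theta>)"
proof -
  have "1-lipschitz_on UNIV (\<lambda>V. circle_map V \<theta>)"
    using norm_circle_map_diff[of _ \<theta>] by (intro lipschitz_onI) (simp_all add: dist_norm[of "circle_map V \<theta>" for V])
  then have "continuous_on UNIV (\<lambda>V. circle_map V \<theta>)"
    by (rule lipschitz_on_continuous_on)
  from continuous_on_compose2[OF this continuous_on_snd[OF continuous_on_id]] show ?thesis
    by simp
qed

text \<open>The parameter \<epsilon> is fixed and its factor absorbed into \<open>y\<close>.
  Smallness then becomes the single inequality \<open>small\<close>: the stability constant of the
  linear equation times the Lipschitz constant of the forcing is at most 1/4. Smoothness is asked
  along curves, the form in which the bootstrap uses it.\<close>

locale delay_system =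
  fixes w lam h ly lr :: real
    and y :: "real \<times> real \<Rightarrow> real \<times> real \<Rightarrow> real \<times> real" and \<rho> :: "real \<times> real \<Rightarrow> real"
  assumes w_pos: "w > 0" and lam_neg: "lam < 0"
    and y_shift: "y (u + (1, 0)) (v + (1, 0)) = y u v"
    and \<rho>_shift: "\<rho> (u + (1, 0)) = \<rho> u"
    and y_bound: "norm (y u v) \<le> w / 4"
    and y_lip: "norm (y u v - y u' v') \<le> ly * (norm (u - u') + norm (v - v'))"
    and \<rho>_bound: "\<bar>\<rho> u\<bar> \<le> h"
    and \<rho>_lip: "\<bar>\<rho> u - \<rho> u'\<bar> \<le> lr * norm (u - u')"
    and ly_nonneg: "ly \<ge> 0" and lr_nonneg: "lr \<ge> 0"
    and small: "(1 + 8 / w + 4 / \<bar>lam\<bar>) * (ly * (2 + 3 * h + 6 * w * lr)) \<le> 1 / 4"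
    and y_smooth: "cont_diff n p \<Longrightarrow> cont_diff n q \<Longrightarrow> cont_diff n (\<lambda>\<theta>. y (p \<theta>) (q \<theta>))"
    and \<rho>_smooth: "cont_diff n p \<Longrightarrow> cont_diff n (\<lambda>\<theta>. \<rho> (p \<theta>))"
begin

definition forcing :: "real \<Rightarrow> (real \<Rightarrow> real \<times> real) \<Rightarrow> real \<Rightarrow> real \<times> real" where
  "forcing \<omega> W \<theta> = y (W \<theta>) (W (\<theta> - \<omega> * \<rho> (W \<theta>)))"

definition solution :: "real \<Rightarrow> (real \<Rightarrow> real \<times> real) \<Rightarrow> bool" where
  "solution \<omega> W \<longleftrightarrow> forced_solution w lam \<omega> W (forcing \<omega> W)"

text \<open>Lipschitz constant of the forcing in frequency and curve. The 2 counts the direct change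
  of the curve in both arguments of \<open>y\<close>; \<open>3 * h\<close> is slope times delay, for
  a change of frequency; \<open>6 * w * lr\<close> is slope 3 times frequency at most
  \<open>2 * w\<close> times the variation of \<rho>.\<close>

definition gain :: real where
  "gain = ly * (2 + 3 * h + 6 * w * lr)"

text \<open>The three terms are the contributions of the frequency, of the first component
  (integration over a period) and of the second (maximum principle).\<close>

definition stab :: real where
  "stab = 1 + 8 / w + 4 / \<bar>lam\<bar>"

lemma h_nonneg: "h \<ge> 0"
  using \<rho>_bound[of 0] by linarith

lemma gain_nonneg: "gain \<ge> 0"
  unfolding gain_def using ly_nonneg lr_nonneg w_pos h_nonneg by simp

lemma stab_ge_1: "stab \<ge> 1"
  unfolding stab_def using w_pos by simp

lemma stab_gain: "stab * gain \<le> 1 / 4"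
  unfolding stab_def gain_def by (rule small)

lemma forcing_bound: "norm (forcing \<omega> W \<theta>) \<le> w / 4"
  unfolding forcing_def by (rule y_bound)

lemma forcing_periodic:
  assumes "circle_lift W"
  shows "forcing \<omega> W (\<theta> + 1) = forcing \<omega> W \<theta>"
proof -
  have W: "W (\<theta> + 1) = W \<theta> + (1, 0)" for \<theta>
    using assms by (simp add: circle_lift_def)
  have "W (\<theta> + 1 - c) = W (\<theta> - c) + (1, 0)" for c
    using W[of "\<theta> - c"] by (simp add: algebra_simps)
  then show ?thesis
    by (simp add: forcing_def W \<rho>_shift y_shift)
qed

lemma forcing_shift: "forcing \<omega> (\<lambda>\<theta>. W (\<theta> + a)) = (\<lambda>\<theta>. forcing \<omega> W (\<theta> + a))"
  by (auto simp: forcing_def algebra_simps)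

lemma forcing_smooth:
  assumes "cont_diff n W"
  shows "cont_diff n (forcing \<omega> W)"
proof -
  have "cont_diff n (\<lambda>\<theta>. \<theta> + (- \<omega>) *\<^sub>R \<rho> (W \<theta>))"
    using assms by (intro cont_diff_add cont_diff_scaleR \<rho>_smooth cont_diff_const cont_diff_ident)
  then have "cont_diff n (\<lambda>\<theta>. \<theta> - \<omega> * \<rho> (W \<theta>))"
    by simp
  then show ?thesis
    unfolding forcing_def by (intro y_smooth cont_diff_compose[OF assms] assms)
qed

lemma forcing_continuous: "continuous_on UNIV W \<Longrightarrow> continuous_on UNIV (forcing \<omega> W)"
  using forcing_smooth[of 0 W \<omega>] by simp

text \<open>With delayed times \<open>a\<close> for \<open>V\<close> and \<open>b\<close> for
  \<open>W\<close>, the difference \<open>V a - W b\<close> is split at \<open>W a\<close>: the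
  supremum distance controls \<open>V a - W a\<close>, the slope of \<open>W\<close> controls
  \<open>W a - W b\<close>. Thus \<open>V\<close> may be any approximate solution, without a slope
  bound.\<close>

lemma forcing_diff:
  assumes d: "\<And>\<theta>. norm (V \<theta> - W \<theta>) \<le> d" and W: "\<And>s t. norm (W s - W t) \<le> 3 * \<bar>s - t\<bar>"
    and "\<bar>\<omega>'\<bar> \<le> 2 * w"
  shows "norm (forcing \<omega> V \<theta> - forcing \<omega>' W \<theta>) \<le> gain * (\<bar>\<omega> - \<omega>'\<bar> + d)"
proof -
  define a b where "a = \<theta> - \<omega> * \<rho> (V \<theta>)" and "b = \<theta> - \<omega>' * \<rho> (W \<theta>)"
  have "d \<ge> 0"
    using d[of 0] norm_ge_zero order_trans by blast
  have "a - b = (\<omega>' - \<omega>) * \<rho> (V \<theta>) + \<omega>' * (\<rho> (W \<theta>) - \<rho> (V \<theta>))"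
    by (simp add: a_def b_def algebra_simps)
  then have "\<bar>a - b\<bar> \<le> \<bar>\<omega>' - \<omega>\<bar> * \<bar>\<rho> (V \<theta>)\<bar> + \<bar>\<omega>'\<bar> * \<bar>\<rho> (W \<theta>) - \<rho> (V \<theta>)\<bar>"
    by (metis abs_mult abs_triangle_ineq)
  also have "\<dots> \<le> \<bar>\<omega>' - \<omega>\<bar> * h + (2 * w) * (lr * d)"
  proof (intro add_mono mult_mono)
    have "\<bar>\<rho> (W \<theta>) - \<rho> (V \<theta>)\<bar> \<le> lr * norm (V \<theta> - W \<theta>)"
      using \<rho>_lip[of "W \<theta>" "V \<theta>"] by (simp add: norm_minus_commute)
    also have "\<dots> \<le> lr * d"
      by (intro mult_left_mono d lr_nonneg)
    finally show "\<bar>\<rho> (W \<theta>) - \<rho> (V \<theta>)\<bar> \<le> lr * d" .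
  qed (use \<rho>_bound assms(3) w_pos in auto)
  finally have ab: "\<bar>a - b\<bar> \<le> \<bar>\<omega> - \<omega>'\<bar> * h + (2 * w) * (lr * d)"
    by (simp add: abs_minus_commute)
  have "norm (V a - W b) \<le> norm (V a - W a) + norm (W a - W b)"
    using norm_triangle_ineq[of "V a - W a" "W a - W b"] by simp
  also have "\<dots> \<le> d + 3 * (\<bar>\<omega> - \<omega>'\<bar> * h + (2 * w) * (lr * d))"
    by (rule add_mono[OF d order_trans[OF W mult_left_mono[OF ab]]]) simp
  finally have Vab: "norm (V a - W b) \<le> d + 3 * (\<bar>\<omega> - \<omega>'\<bar> * h + (2 * w) * (lr * d))" .
  have "norm (forcing \<omega> V \<theta> - forcing \<omega>' W \<theta>) \<le> ly * (norm (V \<theta> - W \<theta>) + norm (V a - W b))"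
    unfolding forcing_def a_def b_def by (rule y_lip)
  also have "\<dots> \<le> ly * (d + (d + 3 * (\<bar>\<omega> - \<omega>'\<bar> * h + (2 * w) * (lr * d))))"
    by (intro mult_left_mono add_mono d Vab ly_nonneg)
  also have "\<dots> \<le> ly * ((2 + 3 * h + 6 * w * lr) * (\<bar>\<omega> - \<omega>'\<bar> + d))"
  proof (intro mult_left_mono ly_nonneg)
    have "0 \<le> 2 * \<bar>\<omega> - \<omega>'\<bar> + 6 * w * lr * \<bar>\<omega> - \<omega>'\<bar> + 3 * h * d"
      using w_pos lr_nonneg h_nonneg \<open>d \<ge> 0\<close> by (intro add_nonneg_nonneg) auto
    then show "d + (d + 3 * (\<bar>\<omega> - \<omega>'\<bar> * h + (2 * w) * (lr * d))) \<le> (2 + 3 * h + 6 * w * lr) * (\<bar>\<omega> - \<omega>'\<bar> + d)"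
      by (simp add: algebra_simps)
  qed
  finally show ?thesis
    by (simp add: gain_def mult.assoc)
qed

lemma forced_solution_stability:
  assumes P: "forced_solution w lam \<omega> P g" and Q: "forced_solution w lam \<omega>' Q k"
    and c: "\<And>\<theta>. norm (g \<theta> - k \<theta>) \<le> c" and \<omega>: "\<omega> \<ge> w / 2"
    and k: "\<And>\<theta>. norm (k \<theta>) \<le> w / 4" and phase: "fst (P 0) = fst (Q 0)"
  shows "\<bar>\<omega> - \<omega>'\<bar> + norm (P \<theta> - Q \<theta>) \<le> stab * c"
  using frequency_diff[OF P Q c] forced_solution_diff[OF P Q c lam_neg w_pos \<omega> k phase, of \<theta>]
  by (simp add: stab_def algebra_simps)

lemma solution_frequency:
  assumes "solution \<omega> W"
  shows "\<bar>\<omega> - w\<bar> \<le> w / 4"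
  using forced_solution_frequency assms forcing_bound unfolding solution_def by blast

lemma solution_lipschitz:
  assumes "solution \<omega> W"
  shows "norm (W s - W t) \<le> 3 * \<bar>s - t\<bar>"
  using forced_solution_lipschitz assms forcing_bound lam_neg w_pos unfolding solution_def by blast

lemma solution_shift: "solution \<omega> W \<Longrightarrow> solution \<omega> (\<lambda>\<theta>. W (\<theta> + a))"
  unfolding solution_def forcing_shift by (rule forced_solution_shift)

lemma solution_circle_lift: "solution \<omega> W \<Longrightarrow> circle_lift W"
  by (simp add: solution_def forced_solution_def)

lemma solution_continuous: "solution \<omega> W \<Longrightarrow> continuous_on UNIV W"
  unfolding solution_def by (rule forced_solution_continuous)

lemma solution_smooth:
  assumes "solution \<omega> W"
  shows "cont_diff n W"
proof (induction n)
  case 0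
  then show ?case
    using solution_continuous[OF assms] by simp
next
  case (Suc n)
  obtain W' where W': "\<And>\<theta>. (W has_vector_derivative W' \<theta>) (at \<theta>)"
    "\<And>\<theta>. \<omega> *\<^sub>R W' \<theta> = (w, lam * snd (W \<theta>)) + forcing \<omega> W \<theta>"
    using assms unfolding solution_def forced_solution_def by blast
  have "\<omega> \<noteq> 0"
    using solution_frequency[OF assms] w_pos by auto
  then have "W' \<theta> = (1 / \<omega>) *\<^sub>R ((w, lam *\<^sub>R snd (W \<theta>)) + forcing \<omega> W \<theta>)" for \<theta>
    using arg_cong[OF W'(2)[of \<theta>], of "\<lambda>x. (1 / \<omega>) *\<^sub>R x"] by simp
  moreover have "cont_diff n (\<lambda>\<theta>. (1 / \<omega>) *\<^sub>R ((w, lam *\<^sub>R snd (W \<theta>)) + forcing \<omega> W \<theta>))"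
    by (intro cont_diff_scaleR cont_diff_add cont_diff_Pair cont_diff_const forcing_smooth Suc
        cont_diff_linear[OF bounded_linear_snd])
  ultimately show ?case
    using W'(1) by (intro cont_diff_SucI) auto
qed

text \<open>A self-bounding estimate: the distance \<open>T\<close> of the two pairs makes the
  forcings differ by at most \<open>gain * T + e\<close>, so stability returns
  \<open>T \<le> (stab * gain) * T + stab * e\<close>. As \<open>stab * gain \<le> 1 / 4\<close>,
  the first term is absorbed on the left.\<close>

lemma approximate_solution_close:
  assumes W: "solution \<omega> W"
    and V: "forced_solution w lam \<omega>' V (\<lambda>\<theta>. forcing \<omega>' V \<theta> + r \<theta>)"
    and r: "\<And>\<theta>. norm (r \<theta>) \<le> e" and e: "e \<le> w / 4" and phase: "fst (V 0) = fst (W 0)"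
  shows "\<bar>\<omega>' - \<omega>\<bar> + norm (V \<theta> - W \<theta>) \<le> 2 * stab * e"
proof -
  have "e \<ge> 0"
    using r[of 0] norm_ge_zero order_trans by blast
  \<comment> \<open>Forcing and residual contribute \<open>w / 4\<close> each, which keeps \<omega>'
    within \<open>w / 2\<close> of \<open>w\<close>: the lower bound on the frequency that stability
    requires.\<close>
  have "norm (forcing \<omega>' V \<theta> + r \<theta> - 0) \<le> w / 2" for \<theta>
    using norm_triangle_ineq[of "forcing \<omega>' V \<theta>" "r \<theta>"] forcing_bound[of \<omega>' V \<theta>] r[of \<theta>] e by simp
  from frequency_diff[OF V forced_solution_identity this] have \<omega>': "\<omega>' \<ge> w / 2"
    by linarith
  have "circle_lift V"
    using V by (simp add: forced_solution_def)
  then obtain b where "b \<ge> 0" and b: "\<And>\<theta>. norm (V \<theta> - W \<theta>) \<le> b"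
    using forced_solution_continuous[OF V] solution_circle_lift[OF W] solution_continuous[OF W]
    by (rule circle_lift_bounded_diff) (rule that)
  \<comment> \<open>Absorbing a multiple of \<open>T\<close> requires a finite supremum; periodicity
    of the difference of two lifts provides it.\<close>
  define D where "D = (SUP \<theta>. norm (V \<theta> - W \<theta>))"
  have D: "norm (V \<theta> - W \<theta>) \<le> D" for \<theta>
    unfolding D_def using b by (intro cSUP_upper bdd_aboveI2) auto
  have \<omega>: "\<bar>\<omega>\<bar> \<le> 2 * w"
    using solution_frequency[OF W] w_pos by linarith
  define T where "T = \<bar>\<omega>' - \<omega>\<bar> + D"
  have "norm (forcing \<omega>' V \<theta> + r \<theta> - forcing \<omega> W \<theta>) \<le> gain * T + e" for \<theta>
    using forcing_diff[of V W D \<omega> \<omega>' \<theta>, OF D solution_lipschitz[OF W] \<omega>] r[of \<theta>]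
      norm_triangle_ineq[of "forcing \<omega>' V \<theta> - forcing \<omega> W \<theta>" "r \<theta>"]
    by (simp add: T_def algebra_simps)
  note close = forced_solution_stability[OF V W[unfolded solution_def] this \<omega>' forcing_bound phase]
  have "norm (V \<theta> - W \<theta>) \<le> stab * (gain * T + e) - \<bar>\<omega>' - \<omega>\<bar>" for \<theta>
    using close[of \<theta>] by linarith
  then have "D \<le> stab * (gain * T + e) - \<bar>\<omega>' - \<omega>\<bar>"
    unfolding D_def by (intro cSUP_least) auto
  then have "T \<le> (stab * gain) * T + stab * e"
    by (simp add: T_def algebra_simps)
  moreover have "0 \<le> D"
    using D[of 0] norm_ge_zero order_trans by blast
  then have "0 \<le> T"
    by (simp add: T_def)
  then have "(stab * gain) * T \<le> 1 / 4 * T"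
    by (intro mult_right_mono stab_gain)
  moreover have "0 \<le> stab * e"
    using \<open>e \<ge> 0\<close> stab_ge_1 by simp
  ultimately have "T \<le> 2 * (stab * e)"
    by linarith
  then show ?thesis
    using D[of \<theta>] by (simp add: T_def)
qed

lemma solution_unique:
  assumes "solution \<omega> W" "solution \<omega>' V" "fst (V 0) = fst (W 0)"
  shows "\<omega>' = \<omega> \<and> V = W"
proof -
  have "forced_solution w lam \<omega>' V (\<lambda>\<theta>. forcing \<omega>' V \<theta> + 0)"
    using assms(2) by (simp add: solution_def)
  from approximate_solution_close[OF assms(1) this _ _ assms(3), of 0] w_pos
  have "\<bar>\<omega>' - \<omega>\<bar> + norm (V \<theta> - W \<theta>) \<le> 0" for \<theta>
    by simp
  then have "\<bar>\<omega>' - \<omega>\<bar> = 0" "norm (V \<theta> - W \<theta>) = 0" for \<theta>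
    by (smt (verit) norm_ge_zero)+
  then show ?thesis
    by auto
qed

lemma solution_exists:
  obtains \<omega> W where "solution \<omega> W" "fst (W 0) = 0"
proof -
  \<comment> \<open>The slope bound 3 is closed under uniform convergence and is reproduced by every
    step of the iteration, whatever curve is put in.\<close>
  define S where "S = {p :: real \<times> (real \<Rightarrow>\<^sub>C (real \<times> real)). \<bar>fst p - w\<bar> \<le> w / 4 \<and>
    (\<forall>\<theta>. circle_map (snd p) (\<theta> + 1) = circle_map (snd p) \<theta> + (1, 0)) \<and>
    (\<forall>s t. norm (circle_map (snd p) s - circle_map (snd p) t) \<le> 3 * \<bar>s - t\<bar>)}"
  \<comment> \<open>The phase condition belongs to the iteration step instead of \<open>S\<close>:
    it makes two iterates comparable, and the fixed point inherits it.\<close>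
  define next_iterate where "next_iterate p q \<longleftrightarrow>
    forced_solution w lam (fst q) (circle_map (snd q)) (forcing (fst p) (circle_map (snd p))) \<and>
    fst (circle_map (snd q) 0) = 0" for p q :: "real \<times> (real \<Rightarrow>\<^sub>C (real \<times> real))"
  \<comment> \<open>Any choice of iterate will do, because the stability estimate compares arbitrary
    solutions with the same phase.\<close>
  define T where "T p = (SOME q. next_iterate p q)" for p
  have closed: "closed S"
    unfolding S_def
    by (intro closed_Collect_conj closed_Collect_all closed_Collect_le closed_Collect_eq
        continuous_intros continuous_circle_map_eval)
  have lift: "circle_lift (circle_map (snd p))" if "p \<in> S" for p
    using that by (simp add: S_def circle_lift_def)
  have S_freq: "\<bar>fst p - w\<bar> \<le> w / 4"
    and S_lip: "norm (circle_map (snd p) s - circle_map (snd p) t) \<le> 3 * \<bar>s - t\<bar>" if "p \<in> S" for p s t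
    using that unfolding S_def by blast+
  have T: "next_iterate p (T p)" if "p \<in> S" for p
  proof -
    obtain \<omega> P where P: "forced_solution w lam \<omega> P (forcing (fst p) (circle_map (snd p)))" "fst (P 0) = 0"
      by (rule forced_solution_exists[OF forcing_continuous forcing_periodic forcing_bound lam_neg w_pos])
         (rule continuous_circle_map lift[OF \<open>p \<in> S\<close>] that; assumption?)+
    have "circle_lift P"
      using P(1) by (simp add: forced_solution_def)
    then obtain V where "circle_map V = P"
      using forced_solution_continuous[OF P(1)] by (rule circle_map_exists) (rule that)
    with P have "next_iterate p (\<omega>, V)"
      by (simp add: next_iterate_def)
    then show ?thesis
      unfolding T_def by (rule someI)
  qed
  have TS: "T p \<in> S" if "p \<in> S" for p
  proof -
    note q = T[OF that, unfolded next_iterate_def, THEN conjunct1]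
    have "\<bar>fst (T p) - w\<bar> \<le> w / 4"
      by (rule forced_solution_frequency[OF q forcing_bound])
    moreover have "circle_map (snd (T p)) (\<theta> + 1) = circle_map (snd (T p)) \<theta> + (1, 0)" for \<theta>
      using q by (simp add: forced_solution_def circle_lift_def)
    moreover have "norm (circle_map (snd (T p)) s - circle_map (snd (T p)) t) \<le> 3 * \<bar>s - t\<bar>" for s t
      by (rule forced_solution_lipschitz[OF q forcing_bound lam_neg w_pos])
    ultimately show ?thesis
      unfolding S_def by blast
  qed
  have contraction: "dist (T p) (T q) \<le> 1 / 2 * dist p q" if "p \<in> S" "q \<in> S" for p q
  proof -
    define D where "D = dist p q"
    have "dist (fst p) (fst q) \<le> D" "dist (snd p) (snd q) \<le> D"
      unfolding D_def by (rule dist_fst_le dist_snd_le)+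
    then have pq: "\<bar>fst p - fst q\<bar> \<le> D" "norm (circle_map (snd p) \<theta> - circle_map (snd q) \<theta>) \<le> D" for \<theta>
      using norm_circle_map_diff[of "snd p" \<theta> "snd q"] by (simp_all add: dist_real_def)
    have "\<bar>fst q\<bar> \<le> 2 * w"
      using S_freq[OF that(2)] w_pos by linarith
    have "norm (forcing (fst p) (circle_map (snd p)) \<theta> - forcing (fst q) (circle_map (snd q)) \<theta>)
      \<le> gain * (2 * D)" for \<theta>
    proof -
      have "norm (forcing (fst p) (circle_map (snd p)) \<theta> - forcing (fst q) (circle_map (snd q)) \<theta>)
        \<le> gain * (\<bar>fst p - fst q\<bar> + D)"
        by (rule forcing_diff[OF pq(2) S_lip[OF that(2)] \<open>\<bar>fst q\<bar> \<le> 2 * w\<close>])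
      also have "\<dots> \<le> gain * (2 * D)"
        using pq(1) by (intro mult_left_mono gain_nonneg) auto
      finally show ?thesis .
    qed
    note close = forced_solution_stability[OF
        T[OF that(1), unfolded next_iterate_def, THEN conjunct1]
        T[OF that(2), unfolded next_iterate_def, THEN conjunct1] this _ forcing_bound]
    have *: "\<bar>fst (T p) - fst (T q)\<bar> + norm (circle_map (snd (T p)) \<theta> - circle_map (snd (T q)) \<theta>)
        \<le> stab * (gain * (2 * D))" for \<theta>
    proof (rule close)
      show "w / 2 \<le> fst (T p)"
        using S_freq[OF TS[OF that(1)]] w_pos by linarith
      show "fst (circle_map (snd (T p)) 0) = fst (circle_map (snd (T q)) 0)"
        using T[OF that(1)] T[OF that(2)] unfolding next_iterate_def by linarith
    qed
    \<comment> \<open>Frequencies and curves each differ by at most \<open>D\<close>, hence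
      \<open>2 * D\<close>; with \<open>stab * gain \<le> 1 / 4\<close> the contraction factor is
      1/2.\<close>
    have "stab * (gain * (2 * D)) \<le> 1 / 2 * D"
      using mult_right_mono[OF stab_gain, of "2 * D"] by (simp add: D_def mult.assoc)
    then have "norm (circle_map (snd (T p)) \<theta> - circle_map (snd (T q)) \<theta>)
        \<le> 1 / 2 * D - \<bar>fst (T p) - fst (T q)\<bar>" for \<theta>
      using *[of \<theta>] by linarith
    then have "dist (snd (T p)) (snd (T q)) \<le> 1 / 2 * D - \<bar>fst (T p) - fst (T q)\<bar>"
      by (rule dist_le_circle_map_diff)
    moreover have "dist (T p) (T q) \<le> dist (fst (T p)) (fst (T q)) + dist (snd (T p)) (snd (T q))"
      unfolding dist_prod_def by (rule sqrt_sum_squares_le_sum) auto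
    ultimately show ?thesis
      by (simp add: dist_real_def D_def)
  qed
  obtain V where V: "circle_map V = (\<lambda>\<theta>. (\<theta>, 0))"
    by (rule circle_map_exists[OF circle_lift_identity]) (auto intro!: continuous_intros)
  have "(w, V) \<in> S"
    using w_pos by (auto simp: S_def V norm_Pair)
  then have "\<exists>!p\<in>S. T p = p"
    using closed TS by (intro Banach_fix[of S "1 / 2"] contraction) (auto simp: complete_eq_closed)
  then obtain p where "p \<in> S" "T p = p"
    by blast
  with T[of p] have "solution (fst p) (circle_map (snd p))" "fst (circle_map (snd p) 0) = 0"
    by (simp_all add: next_iterate_def solution_def)
  with that show ?thesis .
qed

end

section \<open>Approximate solutions\<close>

lemma deriv_funpow_shift: "(deriv ^^ k) (\<lambda>x. g (x + a)) = (\<lambda>x. (deriv ^^ k) g (x + a))"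
  for g :: "real \<Rightarrow> real"
proof (induction k)
  case (Suc k)
  then show ?case
    by (auto simp: deriv_def DERIV_shift)
qed simp

lemma deriv_add_const: "deriv (\<lambda>x. g x + c) = deriv g" for g :: "real \<Rightarrow> real"
  by (auto simp: deriv_def has_real_derivative_iff_has_vector_derivative has_vector_derivative_add_const)

lemma deriv_funpow_diff:
  fixes f g :: "real \<Rightarrow> real"
  assumes "\<And>j x. j < n \<Longrightarrow> (deriv ^^ j) f field_differentiable at x"
    "\<And>j x. j < n \<Longrightarrow> (deriv ^^ j) g field_differentiable at x"
  shows "k \<le> n \<Longrightarrow> (deriv ^^ k) (\<lambda>x. f x - g x) = (\<lambda>x. (deriv ^^ k) f x - (deriv ^^ k) g x)"
proof (induction k)
  case (Suc k)
  then show ?case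
    using assms[of k] by auto
qed simp

text \<open>Bounds on the whole line, with order 0 of the first component left out because a lift is
  unbounded there.\<close>

definition derivs_bounded :: "nat \<Rightarrow> (real \<Rightarrow> real \<times> real) \<Rightarrow> real \<Rightarrow> bool" where
  "derivs_bounded n V M \<longleftrightarrow> (\<forall>k\<le>n. \<forall>x.
    (k > 0 \<longrightarrow> \<bar>(deriv ^^ k) (fst \<circ> V) x\<bar> \<le> M) \<and> \<bar>(deriv ^^ k) (snd \<circ> V) x\<bar> \<le> M)"

lemma derivs_bounded_shift:
  assumes "derivs_bounded n V M"
  shows "derivs_bounded n (\<lambda>x. V (x + a)) M"
proof -
  have "fst \<circ> (\<lambda>x. V (x + a)) = (\<lambda>x. (fst \<circ> V) (x + a))" "snd \<circ> (\<lambda>x. V (x + a)) = (\<lambda>x. (snd \<circ> V) (x + a))"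
    by auto
  then show ?thesis
    using assms unfolding derivs_bounded_def by (simp only: deriv_funpow_shift) blast
qed

lemma derivs_bounded_mono: "derivs_bounded n V M \<Longrightarrow> M \<le> M' \<Longrightarrow> derivs_bounded n V M'"
  unfolding derivs_bounded_def by (blast intro: order_trans[of _ M M'])

text \<open>The norm looks at one period only. Derivatives of the second component are periodic, and
  those of the first are from order 1 on, once the added constant 1 has been differentiated
  away.\<close>

lemma derivs_bounded_C_norm:
  assumes V: "circle_lift V" "C_class n V"
  shows "derivs_bounded n V (C_norm n V)"
proof -
  have "(\<lambda>x. (snd \<circ> V) (x + 1)) = snd \<circ> V" and fst_shift: "(\<lambda>x. (fst \<circ> V) (x + 1)) = (\<lambda>x. (fst \<circ> V) x + 1)"
    using V(1) by (auto simp: circle_lift_def)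
  then have snd_per: "(deriv ^^ k) (snd \<circ> V) (x + 1) = (deriv ^^ k) (snd \<circ> V) x" for k x
    using fun_cong[OF deriv_funpow_shift[of k "snd \<circ> V" 1], of x] by simp
  have "deriv (\<lambda>x. (fst \<circ> V) (x + 1)) = deriv (fst \<circ> V)"
    unfolding fst_shift by (rule deriv_add_const)
  then have "(deriv ^^ Suc k) (\<lambda>x. (fst \<circ> V) (x + 1)) = (deriv ^^ Suc k) (fst \<circ> V)" for k
    by (simp only: funpow_Suc_right o_apply)
  then have fst_per: "(deriv ^^ Suc k) (fst \<circ> V) (x + 1) = (deriv ^^ Suc k) (fst \<circ> V) x" for k x
    using fun_cong[OF deriv_funpow_shift[of "Suc k" "fst \<circ> V" 1], of x] by simp
  have "\<bar>(deriv ^^ k) (snd \<circ> V) x\<bar> \<le> C_norm n V" if "k \<le> n" for k x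
    by (rule periodic_le[of "\<lambda>x. \<bar>(deriv ^^ k) (snd \<circ> V) x\<bar>"])
       (use C_norm_ge(2)[OF V(2) that] snd_per[of k] in auto)
  moreover have "\<bar>(deriv ^^ k) (fst \<circ> V) x\<bar> \<le> C_norm n V" if k: "k \<le> n" "k > 0" for k x
  proof -
    obtain j where j: "k = Suc j"
      using k(2) by (cases k) auto
    show ?thesis
      by (rule periodic_le[of "\<lambda>x. \<bar>(deriv ^^ k) (fst \<circ> V) x\<bar>"])
         (use C_norm_ge(1)[OF V(2) k(1)] fst_per[of j] in \<open>simp_all only: j\<close>)
  qed
  ultimately show ?thesis
    unfolding derivs_bounded_def by blast
qed

lemma C_class_DERIV:
  assumes "C_class n V" "k < n"
  shows "((deriv ^^ k) (fst \<circ> V) has_real_derivative (deriv ^^ Suc k) (fst \<circ> V) x) (at x)"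
    "((deriv ^^ k) (snd \<circ> V) has_real_derivative (deriv ^^ Suc k) (snd \<circ> V) x) (at x)"
  using assms unfolding C_class_def by (simp_all add: DERIV_deriv_iff_field_differentiable)

section \<open>Derivatives of the difference of two lifts with a common phase\<close>

locale two_lifts =
  fixes L :: nat and V W :: "real \<Rightarrow> real \<times> real" and M B a :: real
  assumes L_pos: "L > 0" and lift: "circle_lift V" "circle_lift W"
    and classes: "C_class L V" "C_class L W"
    and bounded: "derivs_bounded L V M" "derivs_bounded L W B"
    and phase: "fst (V a) = fst (W a)"
begin

definition fst_diff where "fst_diff k x = (deriv ^^ k) (fst \<circ> V) x - (deriv ^^ k) (fst \<circ> W) x"
definition snd_diff where "snd_diff k x = (deriv ^^ k) (snd \<circ> V) x - (deriv ^^ k) (snd \<circ> W) x"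

lemma diff_DERIV:
  assumes "k < L"
  shows "(fst_diff k has_real_derivative fst_diff (Suc k) x) (at x)"
    "(snd_diff k has_real_derivative snd_diff (Suc k) x) (at x)"
  unfolding fst_diff_def[abs_def] snd_diff_def[abs_def]
  by (intro DERIV_diff C_class_DERIV[OF classes(1) assms] C_class_DERIV[OF classes(2) assms])+

lemma diff_zero: "fst_diff 0 x = fst (V x - W x)" "snd_diff 0 x = snd (V x - W x)"
  by (simp_all add: fst_diff_def snd_diff_def)

lemma snd_diff_bound: "k \<le> L \<Longrightarrow> \<bar>snd_diff k x\<bar> \<le> M + B"
  using bounded abs_triangle_ineq4[of "(deriv ^^ k) (snd \<circ> V) x" "(deriv ^^ k) (snd \<circ> W) x"]
  unfolding derivs_bounded_def snd_diff_def by (smt (verit))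

text \<open>For order 0 the common value at \<open>a\<close> replaces the missing bound: the
  difference is periodic, vanishes at \<open>a\<close> and has slope at most \<open>M + B\<close>,
  so over one period it cannot exceed \<open>M + B\<close>.\<close>

lemma fst_diff_bound:
  assumes "k \<le> L"
  shows "\<bar>fst_diff k x\<bar> \<le> M + B"
proof -
  have pos: "\<bar>fst_diff k x\<bar> \<le> M + B" if "k \<le> L" "k > 0" for k x
    using bounded that abs_triangle_ineq4[of "(deriv ^^ k) (fst \<circ> V) x" "(deriv ^^ k) (fst \<circ> W) x"]
    unfolding derivs_bounded_def fst_diff_def by (smt (verit))
  have "\<bar>fst_diff 0 (x - a + a)\<bar> \<le> M + B"
  proof (rule periodic_le[of "\<lambda>x. \<bar>fst_diff 0 (x + a)\<bar>"])
    fix x :: real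
    have "x + 1 + a = (x + a) + 1"
      by simp
    then show "\<bar>fst_diff 0 (x + 1 + a)\<bar> = \<bar>fst_diff 0 (x + a)\<bar>"
      using lift by (simp only: circle_lift_def diff_zero) simp
    assume x: "x \<in> {0..1}"
    have "\<bar>fst_diff 0 (x + a) - fst_diff 0 a\<bar> \<le> (M + B) * \<bar>x + a - a\<bar>"
      by (rule increment_bound[of _ "fst_diff (Suc 0)"]) (use diff_DERIV L_pos pos in auto)
    also have "\<dots> \<le> (M + B) * 1"
      using x snd_diff_bound[of 0 0] by (intro mult_left_mono) auto
    finally show "\<bar>fst_diff 0 (x + a)\<bar> \<le> M + B"
      using phase by (simp add: diff_zero)
  qed
  with pos[OF assms] show ?thesis
    by (cases "k = 0") auto
qed

lemma diff_bound: "norm (V x - W x) \<le> 2 * (M + B)"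
  using norm_le_abs_sum[of "V x - W x"] fst_diff_bound[of 0 x] snd_diff_bound[of 0 x]
  by (simp add: diff_zero)

lemma C_norm_diff_le:
  assumes e: "\<And>x. norm (V x - W x) \<le> K * e" "e \<ge> 0" and N: "M + B \<le> N" "1 \<le> N" "N \<le> K" and "l < L"
  shows "C_norm l (\<lambda>x. V x - W x) \<le> 8 ^ (L * L) * K * N * e powr (1 - real l / real L)"
proof (rule C_norm_le)
  fix k x assume k: "k \<le> l"
  have kL: "k \<le> L"
    using k \<open>l < L\<close> by simp
  have diff: "(deriv ^^ j) (c \<circ> V) field_differentiable at x" "(deriv ^^ j) (c \<circ> W) field_differentiable at x"
    if "j < L" "c = fst \<or> c = snd" for j x and c :: "real \<times> real \<Rightarrow> real"
    using classes that unfolding C_class_def by blast+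
  have "fst \<circ> (\<lambda>x. V x - W x) = (\<lambda>x. (fst \<circ> V) x - (fst \<circ> W) x)"
    "snd \<circ> (\<lambda>x. V x - W x) = (\<lambda>x. (snd \<circ> V) x - (snd \<circ> W) x)"
    by auto
  then have eq: "(deriv ^^ k) (fst \<circ> (\<lambda>x. V x - W x)) x = fst_diff k x"
    "(deriv ^^ k) (snd \<circ> (\<lambda>x. V x - W x)) x = snd_diff k x"
    using deriv_funpow_diff[of L "fst \<circ> V" "fst \<circ> W" k] deriv_funpow_diff[of L "snd \<circ> V" "snd \<circ> W" k]
      diff kL by (simp_all only: fst_diff_def snd_diff_def) auto
  have small: "\<bar>fst_diff 0 x\<bar> \<le> K * e" "\<bar>snd_diff 0 x\<bar> \<le> K * e" for x
    unfolding diff_zero using order_trans[OF abs_fst_le_norm e(1)] order_trans[OF abs_snd_le_norm e(1)]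
    by blast+
  have large: "\<bar>fst_diff j x\<bar> \<le> N" "\<bar>snd_diff j x\<bar> \<le> N" if "j \<le> L" for j x
    using order_trans[OF fst_diff_bound[OF that] N(1)] order_trans[OF snd_diff_bound[OF that] N(1)]
    by blast+
  show "\<bar>(deriv ^^ k) (fst \<circ> (\<lambda>x. V x - W x)) x\<bar> \<le> 8 ^ (L * L) * K * N * e powr (1 - real l / real L)"
    unfolding eq
    by (rule derivative_interpolation_error[OF diff_DERIV(1) small(1) e(2) large(1) N(2,3) k \<open>l < L\<close>])
  show "\<bar>(deriv ^^ k) (snd \<circ> (\<lambda>x. V x - W x)) x\<bar> \<le> 8 ^ (L * L) * K * N * e powr (1 - real l / real L)"
    unfolding eq
    by (rule derivative_interpolation_error[OF diff_DERIV(2) small(2) e(2) large(2) N(2,3) k \<open>l < L\<close>])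
qed

end

lemma C_class_has_vector_derivative:
  assumes "C_class n V" "n > 0"
  shows "(V has_vector_derivative (deriv (fst \<circ> V) x, deriv (snd \<circ> V) x)) (at x)"
  using C_class_DERIV[OF assms, of x] by (simp add: has_vector_derivative_prod_iff o_def)

section \<open>Comparison of approximate solutions with the exact one\<close>

context delay_system
begin

definition residual :: "real \<Rightarrow> (real \<Rightarrow> real \<times> real) \<Rightarrow> real \<Rightarrow> real \<times> real" where
  "residual \<omega> V \<theta> = \<omega> *\<^sub>R vector_derivative V (at \<theta>) - (w, lam * snd (V \<theta>)) - forcing \<omega> V \<theta>"

lemma residual_forced_solution:
  assumes "circle_lift V" "C_class n V" "n > 0"
  shows "forced_solution w lam \<omega> V (\<lambda>\<theta>. forcing \<omega> V \<theta> + residual \<omega> V \<theta>)"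
proof -
  have "(V has_vector_derivative vector_derivative V (at \<theta>)) (at \<theta>)" for \<theta>
    using C_class_has_vector_derivative[OF assms(2,3), of \<theta>] vector_derivative_at by metis
  then show ?thesis
    unfolding forced_solution_def
    by (intro conjI exI[of _ "\<lambda>\<theta>. vector_derivative V (at \<theta>)"] assms(1)) (simp add: residual_def)
qed

text \<open>The factor 2 passes from the larger component to the Euclidean norm. Continuity makes
  the suprema behind the norm genuine bounds, and periodicity extends them to the line.\<close>

lemma residual_le_C_norm:
  assumes V: "circle_lift V" "C_class n V" "n > 0"
  shows "norm (residual \<omega> V \<theta>) \<le> 2 * C_norm 0 (residual \<omega> V)"
proof -
  have deriv: "vector_derivative V (at \<theta>) = (deriv (fst \<circ> V) \<theta>, deriv (snd \<circ> V) \<theta>)" for \<theta>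
    by (rule vector_derivative_at[OF C_class_has_vector_derivative[OF V(2,3)]])
  have "continuous_on UNIV (\<lambda>\<theta>. vector_derivative V (at \<theta>))"
    unfolding deriv using C_class_continuous_deriv[OF V(2), of 1] V(3)
    by (intro continuous_on_Pair) simp_all
  moreover have "continuous_on UNIV V"
    using C_class_has_vector_derivative[OF V(2,3)]
    by (blast intro: continuous_at_imp_continuous_on has_vector_derivative_continuous)
  moreover note forcing_continuous[OF this, of \<omega>]
  ultimately have cont: "continuous_on UNIV (residual \<omega> V)"
    unfolding residual_def[abs_def] by (intro continuous_intros)
  then have "C_class 0 (residual \<omega> V)"
    unfolding C_class_def by (auto intro!: continuous_intros simp: o_def)
  then have le: "\<bar>fst (residual \<omega> V x)\<bar> \<le> C_norm 0 (residual \<omega> V)"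
    "\<bar>snd (residual \<omega> V x)\<bar> \<le> C_norm 0 (residual \<omega> V)" if "x \<in> {0..1}" for x
    using C_norm_ge[of 0 "residual \<omega> V" 0 x] that by simp_all
  have V1: "V (x + 1) = V x + (1, 0)" for x
    using V(1) by (simp add: circle_lift_def)
  have "vector_derivative V (at (x + 1)) = vector_derivative V (at x)" for x
  proof -
    have "((\<lambda>x. V (x + 1)) has_vector_derivative vector_derivative V (at (x + 1))) (at x)"
      using shift_derivative[of V "\<lambda>x. vector_derivative V (at x)" 1]
        C_class_has_vector_derivative[OF V(2,3)] by (simp add: deriv)
    then have "(V has_vector_derivative vector_derivative V (at (x + 1))) (at x)"
      unfolding V1 has_vector_derivative_add_const .
    then show ?thesis
      by (rule vector_derivative_at[symmetric])
  qed
  then have per: "residual \<omega> V (x + 1) = residual \<omega> V x" for x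
    by (simp add: residual_def forcing_periodic[OF V(1)] V1)
  show ?thesis
  proof (rule periodic_le[of "\<lambda>x. norm (residual \<omega> V x)"])
    show "norm (residual \<omega> V x) \<le> 2 * C_norm 0 (residual \<omega> V)" if "x \<in> {0..1}" for x
      using norm_le_abs_sum[of "residual \<omega> V x"] le[OF that] by linarith
  qed (simp add: per)
qed

text \<open>All constants are fixed before the approximate solution is given: \<open>B\<close> comes
  from one normalised exact solution, and a phase shift preserves the bounds on its
  derivatives.\<close>

lemma approximate_solution:
  assumes "L > 0"
  shows "\<exists>C. \<forall>\<omega>' V. C_class L V \<and> circle_lift V \<and> C_norm L V \<le> M \<longrightarrow>
    (\<exists>\<omega> W. solution \<omega> W \<and>
       (\<forall>\<omega>\<^sub>1 W\<^sub>1. solution \<omega>\<^sub>1 W\<^sub>1 \<longrightarrow> \<omega>\<^sub>1 = \<omega> \<and> (\<exists>\<theta>\<^sub>0. \<forall>\<theta>. W\<^sub>1 \<theta> = W (\<theta> + \<theta>\<^sub>0))) \<and>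
       (\<forall>l<L. C_norm l (\<lambda>\<theta>. V \<theta> - W \<theta>) \<le> C * C_norm 0 (residual \<omega>' V) powr (1 - real l / real L)) \<and>
       \<bar>\<omega>' - \<omega>\<bar> \<le> C * C_norm 0 (residual \<omega>' V))"
proof -
  obtain \<omega> W\<^sub>0 where W\<^sub>0: "solution \<omega> W\<^sub>0" "fst (W\<^sub>0 0) = 0"
    by (rule solution_exists) (rule that)
  have W\<^sub>0_class: "C_class L W\<^sub>0" and W\<^sub>0_lift: "circle_lift W\<^sub>0"
    by (rule cont_diff_imp_C_class[OF solution_smooth[OF W\<^sub>0(1)]] solution_circle_lift[OF W\<^sub>0(1)])+
  define B where "B = C_norm L W\<^sub>0"
  define N where "N = max 1 (M + B)"
  \<comment> \<open>One summand per demand: \<open>N\<close> for the interpolation,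
    \<open>4 * stab\<close> for a small error, \<open>16 * N / w\<close> for a large one.\<close>
  define K where "K = N + 4 * stab + 16 * N / w"
  define C where "C = 8 ^ (L * L) * K * N + 4 * stab + 6"
  have N: "1 \<le> N" "M + B \<le> N"
    by (simp_all add: N_def)
  have K: "N \<le> K" "4 * stab \<le> K" "16 * N / w \<le> K"
    using N(1) w_pos stab_ge_1 by (simp_all add: K_def)
  have KN: "0 \<le> 8 ^ (L * L) * K * N"
    using N K by simp
  have "\<exists>\<omega> W. solution \<omega> W \<and>
       (\<forall>\<omega>\<^sub>1 W\<^sub>1. solution \<omega>\<^sub>1 W\<^sub>1 \<longrightarrow> \<omega>\<^sub>1 = \<omega> \<and> (\<exists>\<theta>\<^sub>0. \<forall>\<theta>. W\<^sub>1 \<theta> = W (\<theta> + \<theta>\<^sub>0))) \<and>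
       (\<forall>l<L. C_norm l (\<lambda>\<theta>. V \<theta> - W \<theta>) \<le> C * C_norm 0 (residual \<omega>' V) powr (1 - real l / real L)) \<and>
       \<bar>\<omega>' - \<omega>\<bar> \<le> C * C_norm 0 (residual \<omega>' V)"
    if V: "C_class L V" "circle_lift V" "C_norm L V \<le> M" for \<omega>' V
  proof -
    define e where "e = C_norm 0 (residual \<omega>' V)"
    have res: "norm (residual \<omega>' V \<theta>) \<le> 2 * e" for \<theta>
      unfolding e_def by (rule residual_le_C_norm[OF V(2,1) assms])
    then have e: "e \<ge> 0"
      using order_trans[OF norm_ge_zero res[of 0]] by simp
    have V_forced: "forced_solution w lam \<omega>' V (\<lambda>\<theta>. forcing \<omega>' V \<theta> + residual \<omega>' V \<theta>)"
      by (rule residual_forced_solution[OF V(2,1) assms])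
    obtain a where a: "fst (V a) = 0"
      by (rule circle_lift_zero_phase[OF V(2) forced_solution_continuous[OF V_forced]]) (rule that)
    \<comment> \<open>The exact solution is shifted, so that its phase vanishes where that of the
      given \<open>V\<close> does; \<open>V\<close> itself stays in place.\<close>
    define W where "W \<theta> = W\<^sub>0 (\<theta> + - a)" for \<theta>
    have W: "solution \<omega> W"
      unfolding W_def by (rule solution_shift[OF W\<^sub>0(1)])
    interpret two_lifts L V W M B a
    proof
      show "circle_lift W"
        by (rule solution_circle_lift[OF W])
      show "C_class L W"
        by (rule cont_diff_imp_C_class[OF solution_smooth[OF W]])
      show "derivs_bounded L V M"
        by (rule derivs_bounded_mono[OF derivs_bounded_C_norm[OF V(2,1)] V(3)])
      show "derivs_bounded L W B"
        unfolding W_def B_def by (intro derivs_bounded_shift derivs_bounded_C_norm W\<^sub>0_lift W\<^sub>0_class)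
      show "fst (V a) = fst (W a)"
        using a W\<^sub>0(2) by (simp add: W_def)
    qed (use assms V in auto)
    have close: "\<bar>\<omega>' - \<omega>\<bar> \<le> (4 * stab + 6) * e \<and> norm (V \<theta> - W \<theta>) \<le> K * e" for \<theta>
    proof (cases "2 * e \<le> w / 4")
      case True
      have "forced_solution w lam \<omega>' (\<lambda>\<theta>. V (\<theta> + a))
          (\<lambda>\<theta>. forcing \<omega>' (\<lambda>\<theta>. V (\<theta> + a)) \<theta> + residual \<omega>' V (\<theta> + a))"
        using forced_solution_shift[OF V_forced, of a] by (simp add: forcing_shift)
      from approximate_solution_close[OF W\<^sub>0(1) this res True, of "\<theta> - a"] a W\<^sub>0(2)
      have "\<bar>\<omega>' - \<omega>\<bar> + norm (V \<theta> - W \<theta>) \<le> 4 * stab * e"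
        by (simp add: W_def)
      moreover have "4 * stab * e \<le> K * e"
        by (intro mult_right_mono K e)
      ultimately show ?thesis
        using e norm_ge_zero[of "V \<theta> - W \<theta>"] unfolding distrib_right by linarith
    next
      \<comment> \<open>Here \<open>e > w / 8\<close>. Since \<open>w / 4 < 2 * e\<close>, the
        frequencies \<omega>' and \<omega> are within \<open>4 * e\<close> and \<open>2 * e\<close>
        of \<open>w\<close>, and the a priori bound \<open>2 * N\<close> is at most
        \<open>(16 * N / w) * e\<close>.\<close>
      case False
      have "norm (forcing \<omega>' V \<theta> + residual \<omega>' V \<theta> - 0) \<le> w / 4 + 2 * e" for \<theta>
        using norm_triangle_ineq[of "forcing \<omega>' V \<theta>" "residual \<omega>' V \<theta>"]
          forcing_bound[of \<omega>' V \<theta>] res[of \<theta>] by simp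
      from frequency_diff[OF V_forced forced_solution_identity this]
      have "\<bar>\<omega>' - \<omega>\<bar> \<le> 6 * e"
        using solution_frequency[OF W] False by linarith
      moreover have "0 \<le> stab * e"
        using e stab_ge_1 by simp
      ultimately have "\<bar>\<omega>' - \<omega>\<bar> \<le> (4 * stab + 6) * e"
        by (simp add: distrib_right)
      moreover have "norm (V \<theta> - W \<theta>) \<le> K * e"
      proof -
        have "norm (V \<theta> - W \<theta>) \<le> 2 * N"
          by (rule order_trans[OF diff_bound mult_left_mono[OF N(2)]]) simp
        also have "\<dots> = (16 * N / w) * (w / 8)"
          using w_pos by simp
        also have "\<dots> \<le> K * e"
          using K(3) N(1) K(1) False w_pos by (intro mult_mono) auto
        finally show ?thesis .
      qed
      ultimately show ?thesis
        by blast
    qed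
    \<comment> \<open>Shifted to phase 0 at the origin, any solution coincides with
      \<open>W\<^sub>0\<close>; undoing both shifts yields the offset \<open>a - b\<close>.\<close>
    have "\<omega>\<^sub>1 = \<omega> \<and> (\<exists>\<theta>\<^sub>0. \<forall>\<theta>. W\<^sub>1 \<theta> = W (\<theta> + \<theta>\<^sub>0))" if W\<^sub>1: "solution \<omega>\<^sub>1 W\<^sub>1" for \<omega>\<^sub>1 W\<^sub>1
    proof -
      obtain b where b: "fst (W\<^sub>1 b) = 0"
        by (rule circle_lift_zero_phase[OF solution_circle_lift[OF W\<^sub>1] solution_continuous[OF W\<^sub>1]]) (rule that)
      have "\<omega>\<^sub>1 = \<omega> \<and> (\<lambda>\<theta>. W\<^sub>1 (\<theta> + b)) = W\<^sub>0"
        by (rule solution_unique[OF W\<^sub>0(1) solution_shift[OF W\<^sub>1]]) (use b W\<^sub>0(2) in simp)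
      then have "\<omega>\<^sub>1 = \<omega>" and *: "W\<^sub>1 (\<theta> + b) = W\<^sub>0 \<theta>" for \<theta>
        by (auto dest: fun_cong)
      have "W\<^sub>1 \<theta> = W (\<theta> + (a - b))" for \<theta>
        using *[of "\<theta> - b"] by (simp add: W_def)
      with \<open>\<omega>\<^sub>1 = \<omega>\<close> show ?thesis
        by blast
    qed
    moreover have "C_norm l (\<lambda>\<theta>. V \<theta> - W \<theta>) \<le> C * e powr (1 - real l / real L)" if "l < L" for l
    proof -
      have "C_norm l (\<lambda>\<theta>. V \<theta> - W \<theta>) \<le> 8 ^ (L * L) * K * N * e powr (1 - real l / real L)"
        using close e N K(1) that by (intro C_norm_diff_le) auto
      also have "\<dots> \<le> C * e powr (1 - real l / real L)"
        using stab_ge_1 by (intro mult_right_mono) (auto simp: C_def)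
      finally show ?thesis .
    qed
    moreover have "\<bar>\<omega>' - \<omega>\<bar> \<le> C * e"
    proof -
      have "(4 * stab + 6) * e \<le> C * e"
        using e KN by (intro mult_right_mono) (auto simp: C_def)
      with close[of 0] show ?thesis
        by linarith
    qed
    ultimately show ?thesis
      using W unfolding e_def by blast
  qed
  then show ?thesis
    by blast
qed

text \<open>Smoothness provides one more derivative, whose bound is the Lipschitz constant of the
  \<open>n\<close>-th.\<close>

lemma solution_C_Lip_class:
  assumes "solution \<omega> W"
  shows "C_Lip_class n W"
proof -
  have classes: "C_class (Suc n) W" "C_class n W"
    by (rule cont_diff_imp_C_class[OF solution_smooth[OF assms]])+
  define M where "M = C_norm (Suc n) W"
  have M: "derivs_bounded (Suc n) W M"
    unfolding M_def by (rule derivs_bounded_C_norm[OF solution_circle_lift[OF assms] classes(1)])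
  then have "M \<ge> 0"
    unfolding derivs_bounded_def by (meson abs_ge_zero order_trans le_refl)
  have "M-lipschitz_on UNIV ((deriv ^^ n) (fst \<circ> W))" "M-lipschitz_on UNIV ((deriv ^^ n) (snd \<circ> W))"
    using M \<open>M \<ge> 0\<close> unfolding derivs_bounded_def
    by (auto intro!: lipschitz_onI increment_bound[OF C_class_DERIV(1)[OF classes(1)]]
        increment_bound[OF C_class_DERIV(2)[OF classes(1)]] simp: dist_real_def simp del: funpow.simps)
  with classes(2) show ?thesis
    unfolding C_Lip_class_def by blast
qed

end

section \<open>Lipschitz bounds and periodicity of the data\<close>

lemma bounded_smooth_on_bound:
  assumes "bounded_smooth_on f S"
  obtains b where "b \<ge> 0" "\<And>x. x \<in> S \<Longrightarrow> norm (f x) \<le> b"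
proof -
  obtain D where D: "derivative_family D f S" "\<And>vs. bounded (D vs ` S)"
    using assms unfolding bounded_smooth_on_def by blast
  obtain b where "b > 0" and b: "\<And>x. x \<in> S \<Longrightarrow> norm (D [] x) \<le> b"
    using D(2)[of "[]"] unfolding bounded_pos by blast
  show ?thesis
  proof
    show "norm (f x) \<le> b" if "x \<in> S" for x
      using b[OF that] D(1) that by (simp add: derivative_family_def)
  qed (use \<open>b > 0\<close> in simp)
qed

text \<open>The hypothesis bounds \<open>D [v]\<close> separately for each fixed direction
  \<open>v\<close>. By linearity, summing the bounds over the basis gives an operator norm bound
  uniform on \<open>S\<close>, and convexity allows the mean value inequality.\<close>

lemma bounded_smooth_on_lipschitz:
  fixes f :: "'a::euclidean_space \<Rightarrow> 'b::euclidean_space"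
  assumes "bounded_smooth_on f S" "convex S"
  obtains l where "l \<ge> 0" "\<And>x y. x \<in> S \<Longrightarrow> y \<in> S \<Longrightarrow> norm (f x - f y) \<le> l * norm (x - y)"
proof -
  obtain D where D: "derivative_family D f S" "\<And>vs. bounded (D vs ` S)"
    using assms(1) unfolding bounded_smooth_on_def by blast
  have "\<forall>b. \<exists>c>0. \<forall>x\<in>S. norm (D [b] x) \<le> c"
    using D(2) unfolding bounded_pos by blast
  then obtain c where c: "\<And>b. c b > 0" "\<And>b x. x \<in> S \<Longrightarrow> norm (D [b] x) \<le> c b"
    by metis
  define l where "l = (\<Sum>b\<in>Basis. c b)"
  have der: "(D [] has_derivative (\<lambda>v. D [v] x)) (at x within S)" if "x \<in> S" for x
    using D(1) that unfolding derivative_family_def by blast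
  have on: "onorm (\<lambda>v. D [v] x) \<le> l" if "x \<in> S" for x
  proof (rule onorm_bound)
    interpret T: bounded_linear "\<lambda>v. D [v] x"
      using der[OF that] by (rule has_derivative_bounded_linear)
    show "l \<ge> 0"
      unfolding l_def using c(1) by (intro sum_nonneg) (simp add: less_imp_le)
    fix v
    have "D [v] x = D [\<Sum>b\<in>Basis. (v \<bullet> b) *\<^sub>R b] x"
      by (simp add: euclidean_representation)
    also have "\<dots> = (\<Sum>b\<in>Basis. (v \<bullet> b) *\<^sub>R D [b] x)"
      by (simp add: T.sum T.scaleR)
    also have "norm \<dots> \<le> (\<Sum>b\<in>Basis. norm v * c b)"
      using c(2)[OF that] Basis_le_norm
      by (intro sum_norm_le) (auto intro!: mult_mono)
    finally show "norm (D [v] x) \<le> l * norm v"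
      by (simp add: l_def sum_distrib_left mult.commute)
  qed
  show ?thesis
  proof
    show "l \<ge> 0"
      unfolding l_def using c(1) by (intro sum_nonneg) (simp add: less_imp_le)
    show "norm (f x - f y) \<le> l * norm (x - y)" if "x \<in> S" "y \<in> S" for x y
      using differentiable_bound[OF assms(2) der on that] D(1) that by (simp add: derivative_family_def)
  qed
qed

lemma bounded_smooth_on_cont_diff:
  assumes "bounded_smooth_on f S" "\<And>x. \<gamma> x \<in> S" "cont_diff n \<gamma>"
  shows "cont_diff n (\<lambda>x. f (\<gamma> x))"
proof -
  obtain D where D: "derivative_family D f S"
    using assms(1) unfolding bounded_smooth_on_def by blast
  have "D [] (\<gamma> x) = f (\<gamma> x)" for x
    using D assms(2) by (simp add: derivative_family_def)
  with cont_diff_derivative_family[OF D assms(2,3), of "[]"] show ?thesis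
    by simp
qed

text \<open>Chain rule for a translation, which maps the strip into itself. The shift is general so
  that \<open>c = 1\<close> and \<open>c = - 1\<close> yield both directions of an
  equivalence.\<close>

lemma strip_derivative_shift:
  assumes K: "\<And>\<theta> s. s \<in> {-1..1} \<Longrightarrow> K (\<theta> + c, s) = K (\<theta>, s)" and "u \<in> strip"
    and D: "(K has_derivative D) (at (u + (c, 0)) within strip)"
  shows "(K has_derivative D) (at u within strip)"
proof -
  have shift: "((\<lambda>x. x + (c, 0)) has_derivative (\<lambda>h. h)) (at u within strip)"
    by (auto intro!: derivative_eq_intros)
  have "(K has_derivative D) (at (u + (c, 0)) within (\<lambda>x. x + (c, 0)) ` strip)"
    by (rule has_derivative_subset[OF D]) (auto simp: strip_def)
  from has_derivative_in_compose[OF shift this]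
  have "((\<lambda>x. K (x + (c, 0))) has_derivative D) (at u within strip)" .
  then show ?thesis
    by (rule has_derivative_transform[rotated 2]) (use assms(1,2) in \<open>auto simp: strip_def\<close>)
qed

text \<open>
  \<^const>\<open>frechet_derivative\<close> is a choice operator: the predicates it chooses from agree at \<open>u\<close> and at
  \<open>u + (1, 0)\<close>, hence so do the chosen derivatives.
\<close>

lemma DK_shift:
  assumes K: "\<And>\<theta> s. s \<in> {-1..1} \<Longrightarrow> K (\<theta> + 1, s) = K (\<theta>, s)" and u: "u \<in> strip"
  shows "DK K (u + (1, 0)) = DK K u"
proof -
  have shift_back: "K (\<theta> + - 1, s) = K (\<theta>, s)" if "s \<in> {-1..1}" for \<theta> s
    using K[OF that, of "\<theta> - 1"] by simp
  have u1: "u + (1, 0) \<in> strip"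
    using u by (auto simp: strip_def)
  have "(K has_derivative D) (at (u + (1, 0)) within strip) \<longleftrightarrow> (K has_derivative D) (at u within strip)" for D
  proof
    assume "(K has_derivative D) (at u within strip)"
    then have "(K has_derivative D) (at (u + (1, 0) + (- 1, 0)) within strip)"
      by (simp add: add.assoc zero_prod_def[symmetric])
    then show "(K has_derivative D) (at (u + (1, 0)) within strip)"
      by (rule strip_derivative_shift[OF _ u1, rotated]) (rule shift_back)
  qed (rule strip_derivative_shift[OF K u])
  then show ?thesis
    by (simp add: DK_def frechet_derivative_def)
qed

lemma Y_bar_shift:
  assumes K: "\<And>\<theta> s. s \<in> {-1..1} \<Longrightarrow> K (\<theta> + 1, s) = K (\<theta>, s)"
  shows "Y_bar X K \<phi> (u + (1, 0), v + (1, 0), \<epsilon>) = Y_bar X K \<phi> (u, v, \<epsilon>)"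
proof (cases "\<bar>snd u\<bar> > 1 \<or> \<bar>snd v\<bar> > 1")
  case True
  then show ?thesis
    by (simp add: Y_bar_def)
next
  case False
  then have "u \<in> strip" "v \<in> strip"
    by (auto simp: strip_def mem_Times_iff abs_le_iff)
  moreover have "K (z + (1, 0)) = K z" if "z \<in> strip" for z
    using K[of "snd z" "fst z"] that by (cases z) (auto simp: strip_def)
  moreover have "DK K (u + (1, 0)) = DK K u"
    by (rule DK_shift) (use K \<open>u \<in> strip\<close> in auto)
  ultimately show ?thesis
    by (simp add: Y_bar_def Y_pert_def)
qed

lemma rho_bar_shift:
  assumes K: "\<And>\<theta> s. s \<in> {-1..1} \<Longrightarrow> K (\<theta> + 1, s) = K (\<theta>, s)"
  shows "rho_bar r K \<phi> (u + (1, 0)) = rho_bar r K \<phi> u"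
  using K[of "snd u" "fst u"] by (cases u) (auto simp: rho_bar_def abs_le_iff not_less)

section \<open>The zero-order equation as a delay system\<close>

lemma norm_triple_diff_le:
  fixes u u' v v' :: "real \<times> real"
  shows "norm ((u, v, e :: real) - (u', v', e)) \<le> norm (u - u') + norm (v - v')"
  using norm_Pair_le[of "u - u'" "(v - v', 0 :: real)"] by (simp add: norm_Pair)

theorem theorem9:
  fixes X :: "(real \<times> real) \<times> (real \<times> real) \<Rightarrow> real \<times> real"
    and r :: "real \<times> real \<Rightarrow> real"
    and K :: "real \<times> real \<Rightarrow> real \<times> real"
    and \<phi> :: "real \<Rightarrow> real"
    and \<Gamma> :: "(real \<times> real) set"
    and h \<omega>\<^sub>0 lam\<^sub>0 :: real
    and L :: nat
  assumes X_analytic: "real_analytic_on X UNIV"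
    and cycle: "stable_limit_cycle (\<lambda>x. X (x, 0)) \<Gamma>"
    and r_smooth: "smooth_on r UNIV"
    and r_range: "\<And>x. r x \<in> {0..h}"
    and omega0: "\<omega>\<^sub>0 > 0"
    and lambda0: "lam\<^sub>0 < 0"
    and K_periodic: "\<And>\<theta> s. s \<in> {-1..1} \<Longrightarrow> K (\<theta> + 1, s) = K (\<theta>, s)"
    and K_diffeo: "analytic_local_diffeo_on K strip"
    and K_invariance: "\<And>\<theta> s. s \<in> {-1..1} \<Longrightarrow> X (K (\<theta>, s), 0) = DK K (\<theta>, s) (\<omega>\<^sub>0, lam\<^sub>0 * s)"
    and K_cycle: "bij_betw (\<lambda>\<theta>. K (\<theta>, 0)) {0..<1} \<Gamma>"
    and phi_smooth: "smooth_on \<phi> UNIV"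
    and phi_range: "\<And>x. \<phi> x \<in> {0..1}"
    and phi_one: "\<And>x. \<bar>x\<bar> \<le> 1 / 2 \<Longrightarrow> \<phi> x = 1"
    and phi_zero: "\<And>x. \<bar>x\<bar> > 1 \<Longrightarrow> \<phi> x = 0"
    and Y_bounded: "bounded_smooth_on (Y_bar X K \<phi>) (UNIV \<times> UNIV \<times> {0..})"
    and rho_bounded: "bounded_smooth_on (rho_bar r K \<phi>) UNIV"
    and L_pos: "L > 0"
  shows "\<exists>\<epsilon>\<^sub>0>0. \<forall>\<epsilon>. 0 \<le> \<epsilon> \<and> \<epsilon> < \<epsilon>\<^sub>0 \<longrightarrow>
    (let solution = zero_order_solution \<omega>\<^sub>0 lam\<^sub>0 (Y_bar X K \<phi>) (rho_bar r K \<phi>) \<epsilon>;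
         error = zero_order_error \<omega>\<^sub>0 lam\<^sub>0 (Y_bar X K \<phi>) (rho_bar r K \<phi>) \<epsilon>
     in
      (\<exists>\<omega> W. \<omega> > 0 \<and> C_Lip_class L W \<and> solution \<omega> W) \<and>
      (\<forall>M. \<exists>C :: nat \<Rightarrow> real. \<forall>\<omega>\<^sub>a W\<^sub>a.
         C_Lip_class L W\<^sub>a \<and> circle_lift W\<^sub>a \<and> C_Lip_norm L W\<^sub>a \<le> M \<longrightarrow>
         (\<exists>\<omega> W. solution \<omega> W \<and>
            (\<forall>\<omega>\<^sub>1 W\<^sub>1. solution \<omega>\<^sub>1 W\<^sub>1 \<longrightarrow> \<omega>\<^sub>1 = \<omega> \<and> (\<exists>\<theta>\<^sub>0. \<forall>\<theta>. W\<^sub>1 \<theta> = W (\<theta> + \<theta>\<^sub>0))) \<and>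
            (\<forall>l<L.
               C_norm l (\<lambda>\<theta>. W\<^sub>a \<theta> - W \<theta>) \<le> C l * C_norm 0 (error \<omega>\<^sub>a W\<^sub>a) powr (1 - real l / real L) \<and>
               \<bar>\<omega>\<^sub>a - \<omega>\<bar> \<le> C l * C_norm 0 (error \<omega>\<^sub>a W\<^sub>a)))) \<and>
      (\<forall>\<omega> W. solution \<omega> W \<longrightarrow> (\<forall>k. C_class k W)))"
proof -
  define Y where "Y = Y_bar X K \<phi>"
  define \<rho> where "\<rho> = rho_bar r K \<phi>"
  let ?S = "UNIV \<times> UNIV \<times> {0..} :: ((real \<times> real) \<times> (real \<times> real) \<times> real) set"
  have Y: "bounded_smooth_on Y ?S" and \<rho>: "bounded_smooth_on \<rho> UNIV"
    using Y_bounded rho_bounded by (simp_all add: Y_def \<rho>_def)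
  have "convex ?S"
    by (intro convex_Times convex_UNIV convex_real_interval)
  obtain b where b: "b \<ge> 0" "\<And>x. x \<in> ?S \<Longrightarrow> norm (Y x) \<le> b"
    using Y by (rule bounded_smooth_on_bound) (rule that)
  obtain l where l: "l \<ge> 0" "\<And>x y. x \<in> ?S \<Longrightarrow> y \<in> ?S \<Longrightarrow> norm (Y x - Y y) \<le> l * norm (x - y)"
    using Y \<open>convex ?S\<close> by (rule bounded_smooth_on_lipschitz) (rule that)
  obtain d where d: "d \<ge> 0" "\<And>x. x \<in> UNIV \<Longrightarrow> norm (\<rho> x) \<le> d"
    using \<rho> by (rule bounded_smooth_on_bound) (rule that)
  obtain lr where lr: "lr \<ge> 0" "\<And>x y. x \<in> UNIV \<Longrightarrow> y \<in> UNIV \<Longrightarrow> norm (\<rho> x - \<rho> y) \<le> lr * norm (x - y)"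
    using \<rho> convex_UNIV by (rule bounded_smooth_on_lipschitz) (rule that)
  \<comment> \<open>The left side of \<open>small\<close> for \<open>ly = l\<close>. It is linear in
    \<open>ly\<close>, and the system below has \<open>ly = \<epsilon> * l\<close>, so the condition
    becomes \<open>\<epsilon> * c \<le> 1 / 4\<close>.\<close>
  define c where "c = (1 + 8 / \<omega>\<^sub>0 + 4 / \<bar>lam\<^sub>0\<bar>) * (l * (2 + 3 * d + 6 * \<omega>\<^sub>0 * lr))"
  have "c \<ge> 0"
    unfolding c_def using omega0 l d lr by simp
  \<comment> \<open>The first entry keeps the forcing below \<open>\<omega>\<^sub>0 / 4\<close>, the
    second gives \<open>small\<close>; the added 1 keeps the denominators positive.\<close>
  define \<epsilon>\<^sub>0 where "\<epsilon>\<^sub>0 = min (\<omega>\<^sub>0 / (4 * (b + 1))) (1 / (4 * (c + 1)))"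
  have "\<epsilon>\<^sub>0 > 0"
    using omega0 b \<open>c \<ge> 0\<close> by (simp add: \<epsilon>\<^sub>0_def)
  show ?thesis
    unfolding Y_def[symmetric] \<rho>_def[symmetric]
  proof (intro exI[of _ \<epsilon>\<^sub>0] conjI \<open>\<epsilon>\<^sub>0 > 0\<close> allI impI)
    fix \<epsilon> :: real assume \<epsilon>: "0 \<le> \<epsilon> \<and> \<epsilon> < \<epsilon>\<^sub>0"
    have "\<epsilon> * (4 * (b + 1)) \<le> \<omega>\<^sub>0" "\<epsilon> * (4 * (c + 1)) \<le> 1"
      using \<epsilon> b \<open>c \<ge> 0\<close> by (simp_all add: \<epsilon>\<^sub>0_def pos_less_divide_eq less_imp_le)
    then have \<epsilon>b: "\<epsilon> * b \<le> \<omega>\<^sub>0 / 4" and \<epsilon>c: "\<epsilon> * c \<le> 1 / 4"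
      using \<epsilon> by (simp_all add: algebra_simps)
    interpret delay_system \<omega>\<^sub>0 lam\<^sub>0 d "\<epsilon> * l" lr "\<lambda>u v. \<epsilon> *\<^sub>R Y (u, v, \<epsilon>)" \<rho>
    proof
      show "\<epsilon> *\<^sub>R Y (u + (1, 0), v + (1, 0), \<epsilon>) = \<epsilon> *\<^sub>R Y (u, v, \<epsilon>)" for u v
        unfolding Y_def by (subst Y_bar_shift) (auto intro: K_periodic)
      show "\<rho> (u + (1, 0)) = \<rho> u" for u
        unfolding \<rho>_def by (rule rho_bar_shift) (rule K_periodic)
      show "norm (\<epsilon> *\<^sub>R Y (u, v, \<epsilon>)) \<le> \<omega>\<^sub>0 / 4" for u v
        using mult_left_mono[OF b(2)[of "(u, v, \<epsilon>)"], of \<epsilon>] \<epsilon> \<epsilon>b by simp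
      show "norm (\<epsilon> *\<^sub>R Y (u, v, \<epsilon>) - \<epsilon> *\<^sub>R Y (u', v', \<epsilon>)) \<le> \<epsilon> * l * (norm (u - u') + norm (v - v'))"
        for u v u' v'
      proof -
        have "norm (Y (u, v, \<epsilon>) - Y (u', v', \<epsilon>)) \<le> l * norm ((u, v, \<epsilon>) - (u', v', \<epsilon>))"
          using \<epsilon> by (intro l(2)) auto
        also have "\<dots> \<le> l * (norm (u - u') + norm (v - v'))"
          by (intro mult_left_mono norm_triple_diff_le l(1))
        finally have "\<epsilon> * norm (Y (u, v, \<epsilon>) - Y (u', v', \<epsilon>)) \<le> \<epsilon> * (l * (norm (u - u') + norm (v - v')))"
          using \<epsilon> by (intro mult_left_mono) auto
        then show ?thesis
          using \<epsilon> unfolding scaleR_diff_right[symmetric] norm_scaleR by (simp add: mult.assoc)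
      qed
      show "\<bar>\<rho> u\<bar> \<le> d" "\<bar>\<rho> u - \<rho> u'\<bar> \<le> lr * norm (u - u')" for u u'
        using d(2)[of u] lr(2)[of u u'] by simp_all
      show "(1 + 8 / \<omega>\<^sub>0 + 4 / \<bar>lam\<^sub>0\<bar>) * (\<epsilon> * l * (2 + 3 * d + 6 * \<omega>\<^sub>0 * lr)) \<le> 1 / 4"
        using \<epsilon>c by (simp only: c_def mult_ac)
      show "cont_diff n (\<lambda>\<theta>. \<epsilon> *\<^sub>R Y (p \<theta>, q \<theta>, \<epsilon>))" if "cont_diff n p" "cont_diff n q" for n p q
        using that \<epsilon> by (intro cont_diff_scaleR bounded_smooth_on_cont_diff[OF Y] cont_diff_Pair cont_diff_const) auto
      show "cont_diff n (\<lambda>\<theta>. \<rho> (p \<theta>))" if "cont_diff n p" for n p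
        using that by (intro bounded_smooth_on_cont_diff[OF \<rho>]) auto
    qed (use omega0 lambda0 \<epsilon> l lr in auto)
    have sol: "zero_order_solution \<omega>\<^sub>0 lam\<^sub>0 Y \<rho> \<epsilon> = solution"
    proof (intro ext iffI)
      fix \<omega> W
      {
        assume "zero_order_solution \<omega>\<^sub>0 lam\<^sub>0 Y \<rho> \<epsilon> \<omega> W"
        then show "solution \<omega> W"
          unfolding solution_def forced_solution_def zero_order_solution_def forcing_def
          by (intro conjI exI[of _ "\<lambda>\<theta>. vector_derivative W (at \<theta>)"])
             (auto simp: vector_derivative_works algebra_simps)
      next
        assume "solution \<omega> W"
        then obtain W' where "circle_lift W" and W': "\<And>\<theta>. (W has_vector_derivative W' \<theta>) (at \<theta>)"
          "\<And>\<theta>. \<omega> *\<^sub>R W' \<theta> = (\<omega>\<^sub>0, lam\<^sub>0 * snd (W \<theta>)) + forcing \<omega> W \<theta>"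
          unfolding solution_def forced_solution_def by blast
        moreover have "vector_derivative W (at \<theta>) = W' \<theta>" for \<theta>
          by (rule vector_derivative_at[OF W'(1)])
        ultimately show "zero_order_solution \<omega>\<^sub>0 lam\<^sub>0 Y \<rho> \<epsilon> \<omega> W"
          unfolding zero_order_solution_def by (auto intro: differentiableI_vector simp: forcing_def)
      }
    qed
    have err: "zero_order_error \<omega>\<^sub>0 lam\<^sub>0 Y \<rho> \<epsilon> = residual"
      by (intro ext) (simp add: zero_order_error_def residual_def forcing_def)
    obtain \<omega> W where W: "solution \<omega> W"
      by (rule solution_exists) (rule that)
    have "\<omega> > 0"
      using solution_frequency[OF W] omega0 by linarith
    then have exists: "\<exists>\<omega> W. \<omega> > 0 \<and> C_Lip_class L W \<and> solution \<omega> W"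
      using W solution_C_Lip_class by blast
    have smooth: "\<forall>\<omega> W. solution \<omega> W \<longrightarrow> (\<forall>k. C_class k W)"
      using cont_diff_imp_C_class solution_smooth by blast
    have "\<exists>C :: nat \<Rightarrow> real. \<forall>\<omega>\<^sub>a W\<^sub>a.
         C_Lip_class L W\<^sub>a \<and> circle_lift W\<^sub>a \<and> C_Lip_norm L W\<^sub>a \<le> M \<longrightarrow>
         (\<exists>\<omega> W. solution \<omega> W \<and>
            (\<forall>\<omega>\<^sub>1 W\<^sub>1. solution \<omega>\<^sub>1 W\<^sub>1 \<longrightarrow> \<omega>\<^sub>1 = \<omega> \<and> (\<exists>\<theta>\<^sub>0. \<forall>\<theta>. W\<^sub>1 \<theta> = W (\<theta> + \<theta>\<^sub>0))) \<and>
            (\<forall>l<L.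
               C_norm l (\<lambda>\<theta>. W\<^sub>a \<theta> - W \<theta>) \<le> C l * C_norm 0 (residual \<omega>\<^sub>a W\<^sub>a) powr (1 - real l / real L) \<and>
               \<bar>\<omega>\<^sub>a - \<omega>\<bar> \<le> C l * C_norm 0 (residual \<omega>\<^sub>a W\<^sub>a)))" for M
    proof -
      obtain C where C: "\<forall>\<omega>' V. C_class L V \<and> circle_lift V \<and> C_norm L V \<le> M \<longrightarrow>
        (\<exists>\<omega> W. solution \<omega> W \<and>
          (\<forall>\<omega>\<^sub>1 W\<^sub>1. solution \<omega>\<^sub>1 W\<^sub>1 \<longrightarrow> \<omega>\<^sub>1 = \<omega> \<and> (\<exists>\<theta>\<^sub>0. \<forall>\<theta>. W\<^sub>1 \<theta> = W (\<theta> + \<theta>\<^sub>0))) \<and>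
          (\<forall>l<L. C_norm l (\<lambda>\<theta>. V \<theta> - W \<theta>) \<le> C * C_norm 0 (residual \<omega>' V) powr (1 - real l / real L)) \<and>
          \<bar>\<omega>' - \<omega>\<bar> \<le> C * C_norm 0 (residual \<omega>' V))"
        using approximate_solution[OF L_pos] by blast
      \<comment> \<open>One constant serves every \<open>l < L\<close>.\<close>
      show ?thesis
      proof (intro exI[of _ "\<lambda>_. C"] allI impI)
        fix \<omega>\<^sub>a W\<^sub>a assume a: "C_Lip_class L W\<^sub>a \<and> circle_lift W\<^sub>a \<and> C_Lip_norm L W\<^sub>a \<le> M"
        then have "C_class L W\<^sub>a \<and> circle_lift W\<^sub>a \<and> C_norm L W\<^sub>a \<le> M"
          by (simp add: C_Lip_class_def C_Lip_norm_def)
        from C[rule_format, OF this, of \<omega>\<^sub>a] show "\<exists>\<omega> W. solution \<omega> W \<and>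
            (\<forall>\<omega>\<^sub>1 W\<^sub>1. solution \<omega>\<^sub>1 W\<^sub>1 \<longrightarrow> \<omega>\<^sub>1 = \<omega> \<and> (\<exists>\<theta>\<^sub>0. \<forall>\<theta>. W\<^sub>1 \<theta> = W (\<theta> + \<theta>\<^sub>0))) \<and>
            (\<forall>l<L.
               C_norm l (\<lambda>\<theta>. W\<^sub>a \<theta> - W \<theta>) \<le> C * C_norm 0 (residual \<omega>\<^sub>a W\<^sub>a) powr (1 - real l / real L) \<and>
               \<bar>\<omega>\<^sub>a - \<omega>\<bar> \<le> C * C_norm 0 (residual \<omega>\<^sub>a W\<^sub>a))"
          by blast
      qed
    qed
    with exists smooth show "let solution = zero_order_solution \<omega>\<^sub>0 lam\<^sub>0 Y \<rho> \<epsilon>;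
         error = zero_order_error \<omega>\<^sub>0 lam\<^sub>0 Y \<rho> \<epsilon>
     in
      (\<exists>\<omega> W. \<omega> > 0 \<and> C_Lip_class L W \<and> solution \<omega> W) \<and>
      (\<forall>M. \<exists>C :: nat \<Rightarrow> real. \<forall>\<omega>\<^sub>a W\<^sub>a.
         C_Lip_class L W\<^sub>a \<and> circle_lift W\<^sub>a \<and> C_Lip_norm L W\<^sub>a \<le> M \<longrightarrow>
         (\<exists>\<omega> W. solution \<omega> W \<and>
            (\<forall>\<omega>\<^sub>1 W\<^sub>1. solution \<omega>\<^sub>1 W\<^sub>1 \<longrightarrow> \<omega>\<^sub>1 = \<omega> \<and> (\<exists>\<theta>\<^sub>0. \<forall>\<theta>. W\<^sub>1 \<theta> = W (\<theta> + \<theta>\<^sub>0))) \<and>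
            (\<forall>l<L.
               C_norm l (\<lambda>\<theta>. W\<^sub>a \<theta> - W \<theta>) \<le> C l * C_norm 0 (error \<omega>\<^sub>a W\<^sub>a) powr (1 - real l / real L) \<and>
               \<bar>\<omega>\<^sub>a - \<omega>\<bar> \<le> C l * C_norm 0 (error \<omega>\<^sub>a W\<^sub>a)))) \<and>
      (\<forall>\<omega> W. solution \<omega> W \<longrightarrow> (\<forall>k. C_class k W))"
      unfolding sol err Let_def by blast
  qed
qed

end
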